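(* Let $\mu\in(0,\infty)$ be a fixed number and let $T\sim F_T$, $A\sim F_A$, $\Lambda\sim F_\Lambda$, $B\sim F_B$ be nonnegative random variables, with $A$ and $\Lambda$ independent. Then we have $$0\le \mathsf{E}[T]<1,\quad \mathsf{E}[A\Lambda]=1,\quad \mathsf{E}[A^2]<\infty,\quad \mathsf{E}[\Lambda^2]<\infty\quad\text{and}\quad 0\le \mathsf{E}[B]<\infty$$ if and only if the functional equation $$\hat F(s)=\int_0^\infty\int_0^\infty(1+\lambda\,\sigma_B(\sigma(s)))^{-a}\,\mathrm{d}F_A(a)\,\mathrm{d}F_\Lambda(\lambda),\quad s\ge 0,$$ has exactly one solution $X\sim F$ (a distribution $F$ of a nonnegative random variable $X$) with mean $\mu$ and finite variance. Moreover, in this case, $$\mathsf{Var}[X]=\frac{\mathsf{Var}[A\Lambda]+\mathsf{E}[A\Lambda^2]+\mathsf{E}[B]+\mathsf{E}[T]}{1-\mathsf{E}[T]}\,\mu^2 .$$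
   Context: For a nonnegative random variable $Y$, $Y\sim F_Y$ means that $Y$ has distribution function $F_Y$, and $\hat F_Y(s)=\mathsf{E}[e^{-sY}]=\int_0^\infty e^{-sy}\,\mathrm{d}F_Y(y)$, $s\ge0$, is its Laplace–Stieltjes transform. Integrals $\int_0^\infty$ with respect to distributions include a possible atom at $0$. For a distribution $F$ on $[0,\infty)$ with mean $\mu\in(0,\infty)$ (the unknown of the equation), define $$\sigma(s)=\int_0^\infty\frac{1-\hat F(ts)}{t}\,\mathrm{d}F_T(t),\quad s\ge0,$$ where the integrand at $t=0$ is defined by continuity to be $\mu s$. Equivalently, $\sigma(s)=\mu\int_0^s\hat F_{TZ}(x)\,\mathrm{d}x$, where $Z$ is independent of $T$ and has the length-biased distribution $F_Z(z)=\frac1\mu\int_0^z x\,\mathrm{d}F(x)$, $z\ge0$. Note that $\sigma$ depends on the unknown $F$. Define also $\sigma_B(s)=\int_0^s\hat F_B(t)\,\mathrm{d}t$, $s\ge0$. *)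

theory Defs
  imports "HOL-Probability.Probability"
begin

definition nonneg_distribution :: "real measure \<Rightarrow> bool" where
  "nonneg_distribution F \<longleftrightarrow> real_distribution F \<and> (AE x in F. 0 \<le> x)"

definition LST :: "real measure \<Rightarrow> real \<Rightarrow> real" where
  "LST F s = (LINT y|F. exp (- (s * y)))"

definition mean :: "real measure \<Rightarrow> real" where
  "mean F = (LINT x|F. x)"

text \<open>The integral defining \<^term>\<open>mean\<close> is 0 for a non-integrable
  identity, so existence of the mean is a separate condition.\<close>

definition has_mean :: "real measure \<Rightarrow> real \<Rightarrow> bool" where
  "has_mean F \<mu> \<longleftrightarrow> integrable F (\<lambda>x. x) \<and> mean F = \<mu>"

definition finite_variance :: "real measure \<Rightarrow> bool" where
  "finite_variance F \<longleftrightarrow> integrable F (\<lambda>x. (x - mean F)\<^sup>2)"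

text \<open>At \<open>t = 0\<close> the integrand is extended by continuity; its limit there is
  \<open>s\<close> times the mean of \<open>F\<close>.\<close>

definition sigma_T :: "real measure \<Rightarrow> real measure \<Rightarrow> real \<Rightarrow> real" where
  "sigma_T FT F s =
     (LINT t|FT. (if t = 0 then mean F * s else (1 - LST F (t * s)) / t))"

definition sigma_B :: "real measure \<Rightarrow> real \<Rightarrow> real" where
  "sigma_B FB s = (LBINT t:{0..s}. LST FB t)"

text \<open>For distributions on the half line, \<^const>\<open>sigma_B\<close> and \<^const>\<open>sigma_T\<close> are
  nonnegative at nonnegative arguments, so the base of \<open>powr\<close> below is
  at least 1 and all integrands are bounded.\<close>

definition satisfies_equation ::
  "real measure \<Rightarrow> real measure \<Rightarrow> real measure \<Rightarrow> real measure \<Rightarrow> real measure \<Rightarrow> bool" where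
  "satisfies_equation FT FA FL FB F \<longleftrightarrow>
     (\<forall>s\<ge>0. LST F s =
        (LINT l|FL. (LINT a|FA. (1 + l * sigma_B FB (sigma_T FT F s)) powr (- a))))"

definition is_solution ::
  "real \<Rightarrow> real measure \<Rightarrow> real measure \<Rightarrow> real measure \<Rightarrow> real measure \<Rightarrow> real measure \<Rightarrow> bool" where
  "is_solution \<mu> FT FA FL FB F \<longleftrightarrow>
     nonneg_distribution F \<and> has_mean F \<mu> \<and> finite_variance F \<and>
     satisfies_equation FT FA FL FB F"

end

theory Submission
  imports Defs "HOL-Real_Asymp.Real_Asymp"
begin

text \<open>
  Write \<open>\<phi>(u) = E[(1 + \<Lambda>u)\<^sup>-\<^sup>A]\<close>, so that the equation says that the transform \<open>f\<close> of the
  unknown distribution satisfies \<open>f = \<phi> \<circ> \<sigma>\<^sub>B \<circ> \<sigma>\<close>.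

  \<^bold>\<open>A solution forces the moment conditions.\<close> Put \<open>y = \<sigma>(s)\<close>, \<open>u = \<sigma>\<^sub>B(y)\<close> and let \<open>m\<close> be the second
  moment of the solution. Comparing \<open>(1 - f(s))/s \<rightarrow> \<mu>\<close> with \<open>u/s \<rightarrow> \<mu>\<close> gives \<open>E[A\<Lambda>] = 1\<close>. The second
  order remainder splits as
  \<open>f(s) - 1 + \<mu>s = (\<phi>(u) - 1 + u) + (y - u) + (\<mu>s - y)\<close>,
  where all three terms are nonnegative. After division by \<open>s\<^sup>2\<close> the left side tends to \<open>m/2\<close>, so each
  term on the right stays bounded; each is the expectation of a nonnegative quantity lying below its
  limit, so Fatou's lemma makes the limits integrable and dominated convergence then evaluates them:
  \<open>m = (E[A(A + 1)\<Lambda>\<^sup>2] + E[B]) \<mu>\<^sup>2 + E[T] m\<close>.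
  The first summand is positive, hence \<open>E[T] < 1\<close>, and solving for \<open>m\<close> gives the variance formula
  (\<open>expansion_at_solution\<close>). Independence splits \<open>E[A\<^sup>2\<Lambda>\<^sup>2]\<close> into \<open>E[A\<^sup>2]\<close> and \<open>E[\<Lambda>\<^sup>2]\<close>.

  \<^bold>\<open>The moment conditions give exactly one solution.\<close> The condition \<open>E[A\<Lambda>] = 1\<close> makes \<open>\<phi>\<close>
  1-Lipschitz, as \<open>\<sigma>\<^sub>B\<close> always is, while \<open>\<sigma>\<close> turns a bound \<open>\<bar>f(s) - g(s)\<bar> \<le> K s\<^sup>2\<close> for transforms with the same mean into
  \<open>E[T] K s\<^sup>2\<close>. Thus the right side of the equation is a contraction for the distance
  \<open>sup \<bar>f(s) - g(s)\<bar>/s\<^sup>2\<close> (\<open>equation_rhs_contracts\<close>), and this distance is finite between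
  distributions with equal means and finite second moments, which gives uniqueness. For existence the
  map is iterated from the point mass at \<open>\<mu>\<close>; it preserves the class of transforms with
  \<open>1 - \<mu>s \<le> f(s) \<le> 1 - \<mu>s + m s\<^sup>2/2\<close>, and these bounds say precisely that the mean is \<open>\<mu>\<close> and the second
  moment is at most \<open>m\<close>.

  That the right side is a Laplace--Stieltjes transform at all is a statement about
  Bernstein functions. Instead of Bernstein's theorem, it rests on closure properties
  of the class of transforms: products, mixtures and pointwise limits that are continuous at
  \<open>0\<close> (\<open>is_LST_limit\<close>, by Helly selection). The decisive one is \<open>is_LST_exp_minus_integral\<close>: both \<open>\<sigma>\<close>
  and \<open>\<sigma>\<^sub>B\<close> have the form \<open>E[W (1 - e\<^sup>-\<^sup>s\<^sup>Y)/Y]\<close>, and the exponential of minus such a function is a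
  transform, namely that of an infinitely divisible law.
\<close>

section \<open>Elementary inequalities and expansions\<close>

lemma exp_minus_le_quadratic: "0 \<le> x \<Longrightarrow> exp (- x) \<le> 1 - x + x\<^sup>2 / 2" for x :: real
proof -
  assume x: "0 \<le> x"
  let ?f = "\<lambda>x::real. 1 - x + x\<^sup>2 / 2 - exp (- x)"
  have "?f 0 \<le> ?f x"
  proof (rule DERIV_nonneg_imp_nondecreasing[OF x])
    fix t :: real
    have "(?f has_real_derivative (- 1 + t + exp (- t))) (at t)"
      by (auto intro!: derivative_eq_intros)
    moreover have "0 \<le> - 1 + t + exp (- t)" using exp_ge_add_one_self[of "- t"] by linarith
    ultimately show "\<exists>y. (?f has_real_derivative y) (at t) \<and> 0 \<le> y" by blast
  qed
  thus ?thesis by simp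
qed

lemma ln_one_plus_ge_quadratic:
  fixes x :: real
  assumes "0 \<le> x"
  shows "x - x\<^sup>2 / 2 \<le> ln (1 + x)"
proof -
  let ?f = "\<lambda>x::real. ln (1 + x) - x + x\<^sup>2 / 2"
  have "?f 0 \<le> ?f x"
  proof (rule DERIV_nonneg_imp_nondecreasing[OF assms])
    fix t :: real assume t: "0 \<le> t"
    have "(?f has_real_derivative (1 / (1 + t) - 1 + t)) (at t)"
      using t by (auto intro!: derivative_eq_intros)
    moreover have "1 / (1 + t) - 1 + t = t\<^sup>2 / (1 + t)" using t by (simp add: field_simps power2_eq_square)
    ultimately show "\<exists>y. (?f has_real_derivative y) (at t) \<and> 0 \<le> y" using t by auto
  qed
  thus ?thesis by simp
qed

lemma one_plus_powr_ge:
  fixes x :: real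
  assumes "0 \<le> x" "0 \<le> a"
  shows "1 - a * x \<le> (1 + x) powr (- a)"
proof -
  have "a * ln (1 + x) \<le> a * x" using assms ln_add_one_self_le_self[of x] by (intro mult_left_mono) auto
  thus ?thesis using exp_ge_add_one_self[of "- a * ln (1 + x)"] assms by (simp add: powr_def)
qed

text \<open>Substituting \<open>y = a ln(1 + x)\<close> reduces the bound to the quadratic bounds for \<open>e\<^sup>-\<^sup>y\<close> and for the
  logarithm. The coefficient \<open>a(a + 1)/2\<close> is the second Taylor coefficient of \<open>(1 + x)\<^sup>-\<^sup>a\<close>, so nothing
  is lost in the limit; the second-moment bound of the iteration relies on this sharpness.\<close>

lemma one_plus_powr_le:
  fixes x :: real
  assumes "0 \<le> x" "0 \<le> a"
  shows "(1 + x) powr (- a) \<le> 1 - a * x + a * (a + 1) / 2 * x\<^sup>2"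
proof -
  let ?y = "a * ln (1 + x)"
  have l: "x - x\<^sup>2 / 2 \<le> ln (1 + x)" "ln (1 + x) \<le> x" "0 \<le> ln (1 + x)"
    using assms ln_one_plus_ge_quadratic[of x] ln_add_one_self_le_self[of x] by auto
  have "(1 + x) powr (- a) = exp (- ?y)" using assms by (simp add: powr_def)
  also have "\<dots> \<le> 1 - ?y + ?y\<^sup>2 / 2" by (rule exp_minus_le_quadratic) (use assms in auto)
  also have "\<dots> \<le> 1 - a * (x - x\<^sup>2 / 2) + (a * x)\<^sup>2 / 2"
  proof -
    have "a * (x - x\<^sup>2 / 2) \<le> ?y" by (intro mult_left_mono l assms)
    moreover have "?y\<^sup>2 \<le> (a * x)\<^sup>2" by (intro power_mono mult_left_mono mult_nonneg_nonneg l assms)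
    ultimately show ?thesis by linarith
  qed
  also have "\<dots> = 1 - a * x + a * (a + 1) / 2 * x\<^sup>2" by (simp add: field_simps power2_eq_square)
  finally show ?thesis .
qed

lemma one_plus_powr_diff:
  fixes l :: real
  assumes "0 \<le> l" "0 \<le> a" "0 \<le> u" "u \<le> v"
  shows "(1 + l * v) powr (- a) \<le> (1 + l * u) powr (- a)"
    "(1 + l * u) powr (- a) - (1 + l * v) powr (- a) \<le> a * l * (v - u)"
proof -
  have p: "1 \<le> 1 + l * u" "1 + l * u \<le> 1 + l * v" using assms by (auto intro: mult_left_mono)
  have p0: "0 < 1 + l * u" using p(1) by linarith
  show *: "(1 + l * v) powr (- a) \<le> (1 + l * u) powr (- a)"
    by (rule powr_mono2') (use p0 p(2) assms in auto)
  define d where "d = l * (v - u) / (1 + l * u)"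
  have lv: "0 \<le> l * (v - u)" using assms by (intro mult_nonneg_nonneg) auto
  hence d: "0 \<le> d" using p0 unfolding d_def by (intro divide_nonneg_pos)
  have d2: "d \<le> l * (v - u)"
    using divide_left_mono[OF p(1) lv] p0 unfolding d_def by simp
  have e: "1 + l * v = (1 + l * u) * (1 + d)" 
  proof -
    have "(1 + l * u) * d = l * (v - u)" using p0 by (simp add: d_def)
    thus ?thesis by (simp add: algebra_simps)
  qed
  have "(1 + l * u) powr (- a) - (1 + l * v) powr (- a) = (1 + l * u) powr (- a) * (1 - (1 + d) powr (- a))"
    unfolding e using p0 d by (subst powr_mult) (auto simp: algebra_simps)
  also have "\<dots> \<le> 1 * (a * d)"
  proof (rule mult_mono)
    show "(1 + l * u) powr (- a) \<le> 1" using p(1) p0 assms powr_mono[of "- a" 0 "1 + l * u"] by (simp split: if_splits)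
    show "1 - (1 + d) powr (- a) \<le> a * d" using one_plus_powr_ge[OF d assms(2)] by linarith
    show "0 \<le> 1 - (1 + d) powr (- a)" using d assms(2) powr_mono[of "- a" 0 "1 + d"] by simp
  qed auto
  also have "\<dots> \<le> a * l * (v - u)" using d2 assms by (simp add: mult_left_mono mult.assoc)
  finally show "(1 + l * u) powr (- a) - (1 + l * v) powr (- a) \<le> a * l * (v - u)" .
qed

lemma exp_remainder_limit: "((\<lambda>y::real. (exp (- y) - 1 + y) / y\<^sup>2) \<longlongrightarrow> 1 / 2) (at_right 0)"
  by real_asymp

lemma divide_square_mult_cancel: "x \<noteq> 0 \<Longrightarrow> c * x\<^sup>2 / (x * v)\<^sup>2 = c / v\<^sup>2" for x :: real
  by (simp add: power_mult_distrib)

lemma exp_remainder_scaled_limit: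
  fixes u :: "nat \<Rightarrow> real"
  assumes x: "0 \<le> x" and u: "u \<longlonglongrightarrow> 0" "\<And>n. 0 < u n"
  shows "(\<lambda>n. (exp (- (u n * x)) - 1 + u n * x) / (u n)\<^sup>2) \<longlonglongrightarrow> x\<^sup>2 / 2"
proof (cases "x = 0")
  case False
  have "(\<lambda>n. x * u n) \<longlonglongrightarrow> x * 0" by (intro tendsto_intros u)
  hence "filterlim (\<lambda>n. x * u n) (at_right 0) sequentially"
    using False x u(2) by (intro filterlim_at_withinI) auto
  from tendsto_mult[OF filterlim_compose[OF exp_remainder_limit this] tendsto_const[of "x\<^sup>2"]]
  show ?thesis using False by (simp add: divide_square_mult_cancel mult.commute[of _ x])
qed simp

lemma one_plus_powr_remainder_limit:
  fixes u :: "nat \<Rightarrow> real"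
  assumes l: "0 \<le> l" and u: "u \<longlonglongrightarrow> 0" "\<And>n. 0 < u n"
  shows "(\<lambda>n. ((1 + l * u n) powr (- a) - 1 + a * l * u n) / (u n)\<^sup>2) \<longlonglongrightarrow> a * (a + 1) * l\<^sup>2 / 2"
proof (cases "l = 0")
  case False
  have lim: "((\<lambda>x::real. ((1 + x) powr (- a) - 1 + a * x) / x\<^sup>2) \<longlongrightarrow> a * (a + 1) / 2) (at_right 0)"
    by (real_asymp simp: field_simps)
  have "(\<lambda>n. l * u n) \<longlonglongrightarrow> l * 0" by (intro tendsto_intros u)
  hence "filterlim (\<lambda>n. l * u n) (at_right 0) sequentially"
    using False l u(2) by (intro filterlim_at_withinI) auto
  from tendsto_mult[OF filterlim_compose[OF lim this] tendsto_const[of "l\<^sup>2"]]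
  show ?thesis using False by (simp add: divide_square_mult_cancel mult.assoc)
qed simp

text \<open>The map \<open>c \<mapsto> (1 - c/n)\<^sup>n\<close> is 1-Lipschitz on \<open>[0, n]\<close>, so \<open>c\<^sub>n\<close> may be replaced by its limit.\<close>

lemma exp_limit_perturbed:
  fixes c :: "nat \<Rightarrow> real"
  assumes c: "c \<longlonglongrightarrow> x" and bnd: "\<And>n. 0 \<le> c n" "\<And>n. c n \<le> real (Suc n)"
  shows "(\<lambda>n. (1 - c n / real (Suc n)) ^ Suc n) \<longlonglongrightarrow> exp (- x)"
proof -
  have x0: "0 \<le> x" using LIMSEQ_le_const[OF c] bnd by auto
  have e: "(\<lambda>n. (1 - x / real (Suc n)) ^ Suc n) \<longlonglongrightarrow> exp (- x)"
    using LIMSEQ_Suc[OF tendsto_exp_limit_sequentially[of "- x"]] by simp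
  have "(\<lambda>n. (1 - c n / real (Suc n)) ^ Suc n - (1 - x / real (Suc n)) ^ Suc n) \<longlonglongrightarrow> 0"
  proof (rule Lim_null_comparison)
    show "(\<lambda>n. \<bar>c n - x\<bar>) \<longlonglongrightarrow> 0" using tendsto_rabs[OF LIM_zero[OF c]] by simp
    show "eventually (\<lambda>n. norm ((1 - c n / real (Suc n)) ^ Suc n - (1 - x / real (Suc n)) ^ Suc n) \<le> \<bar>c n - x\<bar>) sequentially"
      using eventually_ge_at_top[of "nat \<lceil>x\<rceil>"]
    proof eventually_elim
      case (elim n)
      hence xn: "x \<le> real (Suc n)" by linarith
      have "norm ((1 - c n / real (Suc n)) ^ Suc n - (1 - x / real (Suc n)) ^ Suc n)
          \<le> real (Suc n) * norm ((1 - c n / real (Suc n)) - (1 - x / real (Suc n)))"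
        by (rule norm_power_diff)
          (use bnd[of n] x0 xn in \<open>auto simp: abs_le_iff divide_le_eq diff_le_eq simp del: of_nat_Suc\<close>)
      also have "\<dots> = \<bar>c n - x\<bar>"
        by (simp add: diff_divide_distrib[symmetric] abs_minus_commute del: of_nat_Suc)
      finally show ?case .
    qed
  qed
  from tendsto_add[OF this e] show ?thesis by simp
qed

lemma convergent_bounded_above:
  fixes X :: "nat \<Rightarrow> real"
  assumes "X \<longlonglongrightarrow> l"
  shows "\<exists>K. \<forall>n. X n \<le> K"
proof -
  obtain K where "\<And>n. norm (X n) \<le> K"
    using convergent_imp_Bseq[OF convergentI[OF assms]] by (metis BseqE)
  hence "X n \<le> K" for n by (metis abs_ge_self order_trans real_norm_def)
  thus ?thesis by blast
qed

text \<open>A sequence below its own limit function is dominated as soon as the limit is integrable, and Fatou's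
  lemma provides that integrability from a bound on the integrals. This is how the existence of each
  moment and its value are obtained together.\<close>

lemma convergence_below_limit:
  fixes h :: "nat \<Rightarrow> 'a \<Rightarrow> real"
  assumes h: "\<And>n. integrable M (h n)" and g[measurable]: "g \<in> borel_measurable M"
    and le: "\<And>n. AE x in M. 0 \<le> h n x \<and> h n x \<le> g x"
    and lim: "AE x in M. (\<lambda>n. h n x) \<longlonglongrightarrow> g x"
    and bnd: "\<And>n. (LINT x|M. h n x) \<le> K"
  shows "integrable M g \<and> (\<lambda>n. LINT x|M. h n x) \<longlonglongrightarrow> (LINT x|M. g x)"
proof -
  have [measurable]: "h n \<in> borel_measurable M" for n using h by auto
  have g0: "AE x in M. 0 \<le> g x" using le[of 0] by eventually_elim auto
  have "(\<integral>\<^sup>+x. ennreal (g x) \<partial>M) = (\<integral>\<^sup>+x. liminf (\<lambda>n. ennreal (h n x)) \<partial>M)"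
  proof (rule nn_integral_cong_AE)
    show "AE x in M. ennreal (g x) = liminf (\<lambda>n. ennreal (h n x))"
      using lim by eventually_elim (auto intro!: lim_imp_Liminf[symmetric])
  qed
  also have "\<dots> \<le> liminf (\<lambda>n. \<integral>\<^sup>+x. ennreal (h n x) \<partial>M)" by (rule nn_integral_liminf) measurable
  also have "\<dots> = liminf (\<lambda>n. ennreal (LINT x|M. h n x))"
    using le by (subst nn_integral_eq_integral[OF h]) auto
  also have "\<dots> \<le> liminf (\<lambda>n. ennreal K)" by (intro Liminf_mono always_eventually allI ennreal_leI bnd)
  also have "\<dots> < \<infinity>" by (simp add: Liminf_const)
  finally have g': "integrable M g" using g0 by (intro integrableI_nonneg) auto
  have "(\<lambda>n. LINT x|M. h n x) \<longlonglongrightarrow> (LINT x|M. g x)"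
  proof (rule integral_dominated_convergence[OF _ _ g' lim])
    show "AE x in M. norm (h n x) \<le> g x" for n using le[of n] by eventually_elim auto
  qed auto
  with g' show ?thesis by blast
qed

section \<open>The primitive of an exponential\<close>

text \<open>The primitive \<open>\<integral>\<^sub>0\<^sup>s e\<^sup>-\<^sup>x\<^sup>y dx\<close> in closed form, an extreme Bernstein function in \<open>s\<close>; mixing over \<open>y\<close>
  produces both \<open>\<sigma>\<close> and \<open>\<sigma>\<^sub>B\<close>.\<close>

definition exp_primitive :: "real \<Rightarrow> real \<Rightarrow> real" where
  "exp_primitive y s = (if y = 0 then s else (1 - exp (- (s * y))) / y)"

lemma measurable_exp_primitive [measurable]:
  assumes [measurable]: "f \<in> borel_measurable M" "g \<in> borel_measurable M"
  shows "(\<lambda>x. exp_primitive (f x) (g x)) \<in> borel_measurable M"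
  unfolding exp_primitive_def by measurable

lemma exp_primitive_0 [simp]: "exp_primitive y 0 = 0"
  by (simp add: exp_primitive_def)

lemma exp_primitive_le: "0 \<le> y \<Longrightarrow> exp_primitive y s \<le> s"
  using exp_ge_add_one_self[of "- (s * y)"] by (auto simp: exp_primitive_def field_simps)

lemma exp_primitive_ge: "0 \<le> y \<Longrightarrow> 0 \<le> s \<Longrightarrow> s - y * s\<^sup>2 / 2 \<le> exp_primitive y s"
  using exp_minus_le_quadratic[of "s * y"]
  by (auto simp: exp_primitive_def field_simps power2_eq_square)

lemma exp_primitive_diff:
  assumes "0 \<le> y" "0 \<le> s" "s \<le> t"
  shows "0 \<le> exp_primitive y t - exp_primitive y s" "exp_primitive y t - exp_primitive y s \<le> t - s"
proof -
  have "exp (- (s * y)) - exp (- (t * y)) = exp (- (s * y)) * (1 - exp (- ((t - s) * y)))"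
    by (simp add: right_diff_distrib exp_add[symmetric] algebra_simps)
  also have "\<dots> \<le> 1 * ((t - s) * y)"
    using assms exp_ge_add_one_self[of "- ((t - s) * y)"]
    by (intro mult_mono) auto
  finally have *: "exp (- (s * y)) - exp (- (t * y)) \<le> (t - s) * y" by simp
  have "exp (- (t * y)) \<le> exp (- (s * y))" using assms by (auto intro: mult_right_mono)
  thus "0 \<le> exp_primitive y t - exp_primitive y s" using assms
    by (auto simp: exp_primitive_def intro!: divide_right_mono)
  show "exp_primitive y t - exp_primitive y s \<le> t - s" using assms *
    by (auto simp: exp_primitive_def diff_divide_distrib[symmetric] divide_le_eq)
qed

lemma exp_primitive_nonneg: "0 \<le> y \<Longrightarrow> 0 \<le> s \<Longrightarrow> 0 \<le> exp_primitive y s"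
  using exp_primitive_diff(1)[of y 0 s] by simp

lemma exp_primitive_tendsto:
  assumes y: "0 \<le> y" and s: "0 \<le> s" and lim: "u \<longlonglongrightarrow> y" and pos: "\<And>n. 0 \<le> u n"
  shows "(\<lambda>n. exp_primitive (u n) s) \<longlonglongrightarrow> exp_primitive y s"
proof (cases "y = 0")
  case True
  have "(\<lambda>n. exp_primitive (u n) s) \<longlonglongrightarrow> s"
  proof (rule tendsto_sandwich)
    have "(\<lambda>n. s - u n * s\<^sup>2 / 2) \<longlonglongrightarrow> s - y * s\<^sup>2 / 2" by (intro tendsto_intros lim) auto
    thus "(\<lambda>n. s - u n * s\<^sup>2 / 2) \<longlonglongrightarrow> s" using True by simp
  qed (use exp_primitive_ge[OF pos s] exp_primitive_le[OF pos] in auto)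
  thus ?thesis using True by (simp add: exp_primitive_def)
next
  case False
  hence "y > 0" using y by auto
  hence "eventually (\<lambda>n. u n > 0) sequentially" using order_tendstoD(1)[OF lim] by auto
  moreover have "(\<lambda>n. (1 - exp (- (s * u n))) / u n) \<longlonglongrightarrow> (1 - exp (- (s * y))) / y"
    using False by (intro tendsto_intros lim)
  ultimately show ?thesis using False unfolding exp_primitive_def
    by (auto intro: Lim_transform_eventually elim!: eventually_mono)
qed

lemma exp_primitive_remainder_limit:
  fixes u :: "nat \<Rightarrow> real"
  assumes b: "0 \<le> b" and u: "u \<longlonglongrightarrow> 0" "\<And>n. 0 < u n"
  shows "(\<lambda>n. (u n - exp_primitive b (u n)) / (u n)\<^sup>2) \<longlonglongrightarrow> b / 2"
proof (cases "b = 0")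
  case False
  have "(u n - exp_primitive b (u n)) / (u n)\<^sup>2 = ((exp (- (u n * b)) - 1 + u n * b) / (u n)\<^sup>2) / b" for n
    using False u(2)[of n] by (simp add: exp_primitive_def field_simps)
  moreover have "(\<lambda>n. ((exp (- (u n * b)) - 1 + u n * b) / (u n)\<^sup>2) / b) \<longlonglongrightarrow> (b\<^sup>2 / 2) / b"
    using False by (intro tendsto_divide exp_remainder_scaled_limit b u) auto
  ultimately show ?thesis using False by (simp add: power2_eq_square)
qed (simp add: exp_primitive_def)

lemma exp_primitive_integral:
  assumes y: "0 \<le> y" and s: "0 \<le> s"
  shows "(LBINT x:{0..s}. exp (- (x * y))) = exp_primitive y s"
proof -
  have "((\<lambda>x. exp (- (x * y))) has_integral (exp_primitive y s - exp_primitive y 0)) {0..s}"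
  proof (rule fundamental_theorem_of_calculus[OF s])
    fix x assume "x \<in> {0..s}"
    show "(exp_primitive y has_vector_derivative exp (- (x * y))) (at x within {0..s})"
      unfolding has_real_derivative_iff_has_vector_derivative[symmetric] exp_primitive_def
      by (cases "y = 0") (auto intro!: derivative_eq_intros)
  qed
  moreover have "set_integrable lborel {0..s} (\<lambda>x. exp (- (x * y)))"
    by (rule borel_integrable_atLeastAtMost') (auto intro!: continuous_intros)
  ultimately show ?thesis
    by (simp add: set_borel_integral_eq_integral integral_unique)
qed

section \<open>Laplace--Stieltjes transforms\<close>

lemma nonneg_distributionD:
  assumes "nonneg_distribution F"
  shows "real_distribution F" "prob_space F" "sets F = sets borel" "space F = UNIV" "AE x in F. 0 \<le> x"
  using assms unfolding nonneg_distribution_def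
  by (auto simp: real_distribution.space_eq_univ real_distribution.events_eq_borel dest: real_distribution.axioms)

lemma nonneg_distribution_distr:
  assumes "prob_space M" "X \<in> borel_measurable M" "AE x in M. (0::real) \<le> X x"
  shows "nonneg_distribution (distr M borel X)"
proof -
  interpret prob_space M by fact
  interpret D: prob_space "distr M borel X" using assms by (intro prob_space_distr) auto
  show ?thesis unfolding nonneg_distribution_def
    using assms by (auto simp: AE_distr_iff real_distribution_def real_distribution_axioms_def D.prob_space_axioms)
qed

lemma LST_distr:
  assumes [measurable]: "X \<in> borel_measurable M"
  shows "LST (distr M borel X) s = (LINT x|M. exp (- (s * X x)))"
  unfolding LST_def by (subst integral_distr) auto

lemma LST_integrable:
  assumes "nonneg_distribution F" "0 \<le> s"
  shows "integrable F (\<lambda>y. exp (- (s * y)))"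
proof -
  note [measurable_cong] = nonneg_distributionD(3)[OF assms(1)]
  interpret prob_space F using nonneg_distributionD[OF assms(1)] by auto
  show ?thesis
    by (rule integrable_const_bound[of _ 1]) (use nonneg_distributionD(5)[OF assms(1)] assms(2) in \<open>auto elim!: eventually_mono\<close>)
qed

lemma LST_antimono:
  assumes F: "nonneg_distribution F" and "0 \<le> s" "s \<le> t"
  shows "LST F t \<le> LST F s"
proof -
  show ?thesis unfolding LST_def
    by (rule integral_mono_AE[OF LST_integrable LST_integrable])
       (use assms nonneg_distributionD(5)[OF F] in \<open>auto elim!: eventually_mono intro: mult_right_mono\<close>)
qed

lemma LST_0: "nonneg_distribution F \<Longrightarrow> LST F 0 = 1"
  unfolding LST_def using prob_space.prob_space[OF nonneg_distributionD(2), of F] by simp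

lemma LST_nonneg: "0 \<le> LST F s"
  unfolding LST_def by (rule integral_nonneg_AE) auto

lemma LST_le_1: "nonneg_distribution F \<Longrightarrow> 0 \<le> s \<Longrightarrow> LST F s \<le> 1"
  using LST_antimono[of F 0 s] LST_0[of F] by auto

lemma measurable_LST [measurable]:
  assumes "nonneg_distribution F"
  shows "LST F \<in> borel_measurable borel"
proof -
  note [measurable_cong] = nonneg_distributionD(3)[OF assms(1)]
  interpret prob_space F using nonneg_distributionD[OF assms(1)] by auto
  show ?thesis unfolding LST_def by measurable
qed

lemma LST_tendsto:
  assumes F: "nonneg_distribution F" and "0 \<le> s"
  shows "(LST F \<longlongrightarrow> LST F s) (at s within {0..})"
proof -
  note [measurable_cong] = nonneg_distributionD(3)[OF F]
  interpret prob_space F using nonneg_distributionD[OF F] by auto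
  show ?thesis
  proof (subst tendsto_at_iff_sequentially, intro allI impI)
    fix X :: "nat \<Rightarrow> real" assume X: "\<forall>i. X i \<in> {0..} - {s}" "X \<longlonglongrightarrow> s"
    show "(LST F \<circ> X) \<longlonglongrightarrow> LST F s" unfolding LST_def comp_def
    proof (rule integral_dominated_convergence[where w="\<lambda>_. 1"])
      show "AE x in F. (\<lambda>i. exp (- (X i * x))) \<longlonglongrightarrow> exp (- (s * x))"
        by (intro AE_I2 tendsto_intros X)
      show "AE x in F. norm (exp (- (X i * x))) \<le> 1" for i
        using nonneg_distributionD(5)[OF F] X(1)[rule_format, of i] by (auto elim!: eventually_mono)
    qed auto
  qed
qed

lemma LST_tendsto_1:
  assumes F: "nonneg_distribution F"
  shows "(LST F \<longlongrightarrow> 1) (at_right 0)"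
proof -
  have "(LST F \<longlongrightarrow> LST F 0) (at 0 within {0<..})"
    by (rule tendsto_within_subset[OF LST_tendsto[OF F, of 0]]) auto
  thus ?thesis using LST_0[OF F] by simp
qed

text \<open>By Fubini, this identifies \<open>\<sigma>\<^sub>B\<close> with an expectation of \<open>exp_primitive\<close>; applied to the exponential
  distribution it also produces the logarithm.\<close>

lemma LST_integral:
  assumes F: "nonneg_distribution F" and s: "0 \<le> s"
  shows "(LBINT x:{0..s}. LST F x) = (LINT y|F. exp_primitive y s)"
proof -
  note F' = nonneg_distributionD[OF F]
  note [measurable_cong] = F'(3)
  interpret F: prob_space F by (rule F')
  interpret P: pair_sigma_finite lborel F ..
  let ?g = "\<lambda>x y. indicator {0..s} x * exp (- (x * max 0 y)) :: real"
  have int: "integrable (lborel \<Otimes>\<^sub>M F) (case_prod ?g)"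
  proof (rule P.Fubini_integrable)
    show "AE x in lborel. integrable F (\<lambda>y. case (x, y) of (x, y) \<Rightarrow> ?g x y)"
      by (auto intro!: AE_I2 F.integrable_const_bound[of _ 1] simp: indicator_def)
    show "integrable lborel (\<lambda>x. LINT y|F. norm (case (x, y) of (x, y) \<Rightarrow> ?g x y))"
    proof (rule Bochner_Integration.integrable_bound[of _ "indicator {0..s} :: real \<Rightarrow> real"])
      show "AE x in lborel. norm (LINT y|F. norm (case (x, y) of (x, y) \<Rightarrow> ?g x y)) \<le> norm (indicator {0..s} x :: real)"
      proof (rule AE_I2)
        fix x :: real
        have "(LINT y|F. norm (?g x y)) \<le> (LINT y|F. indicator {0..s} x)"
          by (rule integral_mono)
            (auto intro!: F.integrable_const_bound[of _ 1] simp: indicator_def)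
        thus "norm (LINT y|F. norm (case (x, y) of (x, y) \<Rightarrow> ?g x y)) \<le> norm (indicator {0..s} x :: real)"
          by (simp add: F.prob_space)
      qed
      show "integrable lborel (indicator {0..s} :: real \<Rightarrow> real)"
        using s by (intro integrable_real_indicator) auto
    qed auto
  qed auto
  have "(LBINT x:{0..s}. LST F x) = (LINT x|lborel. LINT y|F. ?g x y)"
    unfolding set_lebesgue_integral_def LST_def
  proof (rule Bochner_Integration.integral_cong[OF refl])
    fix x :: real
    have "(LINT y|F. exp (- (x * y))) = (LINT y|F. exp (- (x * max 0 y)))"
      by (rule integral_cong_AE) (use F'(5) in \<open>auto elim!: eventually_mono simp: max_def\<close>)
    thus "indicat_real {0..s} x *\<^sub>R (LINT y|F. exp (- (x * y))) = (LINT y|F. ?g x y)" by simp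
  qed
  also have "\<dots> = (LINT y|F. LINT x|lborel. ?g x y)" using P.Fubini_integral[OF int] by simp
  also have "\<dots> = (LINT y|F. exp_primitive (max 0 y) s)"
    by (subst exp_primitive_integral[symmetric]) (auto simp: set_lebesgue_integral_def s)
  also have "\<dots> = (LINT y|F. exp_primitive y s)"
    by (rule integral_cong_AE) (use F'(5) in \<open>auto elim!: eventually_mono simp: max_def\<close>)
  finally show ?thesis .
qed

text \<open>Membership concerns the half line \<open>[0, \<infinity>)\<close>, so that the class is closed under operations that make
  sense for nonnegative arguments only.\<close>

definition is_LST :: "(real \<Rightarrow> real) \<Rightarrow> bool" where
  "is_LST f \<longleftrightarrow> (\<exists>F. nonneg_distribution F \<and> (\<forall>s\<ge>0. f s = LST F s))"

lemma is_LST_random_variable: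
  assumes "prob_space M" "X \<in> borel_measurable M" "AE x in M. (0::real) \<le> X x"
    and "\<And>s. 0 \<le> s \<Longrightarrow> f s = (LINT x|M. exp (- (s * X x)))"
  shows "is_LST f"
  using nonneg_distribution_distr[OF assms(1-3)] LST_distr[OF assms(2)] assms(4)
  unfolding is_LST_def by auto

lemma is_LST_exp: "0 \<le> c \<Longrightarrow> is_LST (\<lambda>s. exp (- (c * s)))"
  by (rule is_LST_random_variable[of "return borel 0" "\<lambda>_. c"])
    (auto intro!: prob_space_return simp: measure_return algebra_simps)

lemma is_LST_cong: "(\<And>s. 0 \<le> s \<Longrightarrow> f s = g s) \<Longrightarrow> is_LST f \<longleftrightarrow> is_LST g"
  unfolding is_LST_def by auto

lemma is_LST_transfer: "is_LST f \<Longrightarrow> (\<And>s. 0 \<le> s \<Longrightarrow> f s = g s) \<Longrightarrow> is_LST g"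
  using is_LST_cong by blast

lemma is_LST_bounds:
  assumes "is_LST f" "0 \<le> s" shows "0 \<le> f s" "f s \<le> 1"
  using assms LST_nonneg LST_le_1 unfolding is_LST_def by auto

lemma is_LST_tendsto_1:
  assumes "is_LST f" shows "(f \<longlongrightarrow> 1) (at_right 0)"
proof -
  obtain F where F: "nonneg_distribution F" "\<forall>s\<ge>0. f s = LST F s" using assms unfolding is_LST_def by auto
  have "eventually (\<lambda>s. LST F s = f s) (at_right 0)"
    using F by (auto simp: eventually_at_filter)
  from Lim_transform_eventually[OF LST_tendsto_1[OF F(1)] this] show ?thesis .
qed

section \<open>Uniqueness and continuity theorems\<close>

text \<open>The transform at the integer \<open>i\<close> is the \<open>i\<close>-th moment of \<open>e\<^sup>-\<^sup>X\<close>, which lives on \<open>[0, 1]\<close>. By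
  Weierstrass approximation these moments determine the integral of every continuous function of
  \<open>e\<^sup>-\<^sup>X\<close>, in particular of the continuous approximations of \<open>1{X \<le> a}\<close>.\<close>

lemma LST_inj:
  assumes F: "nonneg_distribution F" and G: "nonneg_distribution G"
    and eq: "\<And>s. 0 \<le> s \<Longrightarrow> LST F s = LST G s"
  shows "F = G"
proof -
  note [measurable_cong] = nonneg_distributionD(3)[OF F] nonneg_distributionD(3)[OF G]
  interpret F: real_distribution F using nonneg_distributionD[OF F] by auto
  interpret G: real_distribution G using nonneg_distributionD[OF G] by auto
  have int_eq: "integral\<^sup>L F (cts_step a b) = integral\<^sup>L G (cts_step a b)" if "a < b" for a b
  proof -
    \<comment> \<open>the test function in terms of \<open>y = e\<^sup>-\<^sup>x\<close>; it vanishes for \<open>y < e\<^sup>-\<^sup>b\<close>, hence is continuous at \<open>0\<close>\<close>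
    define g where "g y = (if y \<le> 0 then 0 else cts_step a b (- ln y))" for y
    have g_exp: "g (exp (- x)) = cts_step a b x" for x by (simp add: g_def)
    have "isCont g y" for y
    proof (cases "y > 0")
      case True
      have c: "isCont (cts_step a b) z" for z
        using uniformly_continuous_imp_continuous[OF cts_step_uniformly_continuous[OF that]]
        by (simp add: continuous_on_eq_continuous_at)
      have "isCont (\<lambda>y. cts_step a b (- ln y)) y"
        by (rule isCont_o2[OF _ c]) (use True in \<open>auto intro!: continuous_intros\<close>)
      moreover have "eventually (\<lambda>y. g y = cts_step a b (- ln y)) (nhds y)"
        using eventually_nhds_in_open[of "{0<..}" y] True by (auto elim!: eventually_mono simp: g_def)
      ultimately show ?thesis by (simp add: isCont_cong)
    next
      case False
      have "g z = 0" if "z < exp (- b)" for z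
      proof (cases "0 < z")
        case True
        hence "ln z < ln (exp (- b))" using that by (subst ln_less_cancel_iff) auto
        thus ?thesis using True \<open>a < b\<close> by (simp add: g_def cts_step_def)
      qed (simp add: g_def)
      moreover have "y < exp (- b)" using False exp_gt_zero[of "- b"] by linarith
      ultimately have "eventually (\<lambda>y. g y = 0) (nhds y)"
        using eventually_nhds_in_open[of "{..<exp (- b)}" y] by (auto elim!: eventually_mono)
      thus ?thesis by (simp add: isCont_cong)
    qed
    hence cont: "continuous_on {0..1} g" by (simp add: continuous_at_imp_continuous_on)
    have "\<bar>integral\<^sup>L F (cts_step a b) - integral\<^sup>L G (cts_step a b)\<bar> \<le> 2 * e" if "e > 0" for e
    proof -
      obtain p where p: "real_polynomial_function p" "\<And>y. y \<in> {0..1} \<Longrightarrow> \<bar>g y - p y\<bar> < e"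
        using Stone_Weierstrass_real_polynomial_function[OF compact_Icc cont \<open>e > 0\<close>] by blast
      then obtain c n where pc: "p = (\<lambda>x. \<Sum>i\<le>n. c i * x^i)" using real_polynomial_function_imp_sum by blast
      have p_exp: "p (exp (- x)) = (\<Sum>i\<le>n. c i * exp (- (real i * x)))" for x
        by (simp add: pc exp_of_nat_mult[symmetric])
      have *: "\<bar>integral\<^sup>L H (cts_step a b) - (\<Sum>i\<le>n. c i * LST H (real i))\<bar> \<le> e"
        if H: "nonneg_distribution H" for H
      proof -
        note [measurable_cong] = nonneg_distributionD(3)[OF H]
        interpret H: real_distribution H using nonneg_distributionD[OF H] by auto
        have I: "integrable H (\<lambda>x. p (exp (- x)))" unfolding p_exp
          by (intro Bochner_Integration.integrable_sum integrable_mult_right LST_integrable H) auto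
        have "(\<Sum>i\<le>n. c i * LST H (real i)) = (LINT x|H. p (exp (- x)))"
          unfolding p_exp LST_def
          by (subst Bochner_Integration.integral_sum) (auto intro!: LST_integrable H)
        hence "integral\<^sup>L H (cts_step a b) - (\<Sum>i\<le>n. c i * LST H (real i)) = (LINT x|H. cts_step a b x - p (exp (- x)))"
          using I H.integrable_cts_step[OF \<open>a < b\<close>] by (subst Bochner_Integration.integral_diff) auto
        also have "\<bar>\<dots>\<bar> \<le> (LINT x|H. \<bar>cts_step a b x - p (exp (- x))\<bar>)" by (rule integral_abs_bound)
        also have "\<dots> \<le> (LINT x|H. e)"
        proof (rule integral_mono_AE)
          show "AE x in H. \<bar>cts_step a b x - p (exp (- x))\<bar> \<le> e"
            using nonneg_distributionD(5)[OF H]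
          proof eventually_elim
            case (elim x)
            thus ?case using p(2)[of "exp (-x)"] g_exp[of x] by auto
          qed
        qed (use I H.integrable_cts_step[OF \<open>a < b\<close>] in auto)
        finally show ?thesis by (simp add: H.prob_space[simplified])
      qed
      show ?thesis using *[OF F] *[OF G] eq by simp
    qed
    from this[of "\<bar>integral\<^sup>L F (cts_step a b) - integral\<^sup>L G (cts_step a b)\<bar> / 4"]
    show ?thesis by (cases "integral\<^sup>L F (cts_step a b) = integral\<^sup>L G (cts_step a b)") auto
  qed
  have le: "cdf P x \<le> cdf Q x"
    if P: "real_distribution P" and Q: "real_distribution Q"
      and e: "\<And>a b. a < b \<Longrightarrow> integral\<^sup>L P (cts_step a b) = integral\<^sup>L Q (cts_step a b)" for P Q x
  proof -
    interpret P: real_distribution P by fact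
    interpret Q: real_distribution Q by fact
    have "(cdf Q \<longlongrightarrow> cdf Q x) (at_right x)" using Q.cdf_is_right_cont[of x] by (simp add: continuous_within)
    moreover have "eventually (\<lambda>y. cdf P x \<le> cdf Q y) (at_right x)"
      using eventually_at_right_less[of x]
    proof eventually_elim
      case (elim y)
      show ?case using P.cdf_cts_step(1)[OF elim] Q.cdf_cts_step(2)[OF elim] e[OF elim] by linarith
    qed
    ultimately show ?thesis by (intro tendsto_lowerbound[of "cdf Q" _ "at_right x"]) auto
  qed
  have "cdf F = cdf G"
  proof (rule ext)
    fix x
    show "cdf F x = cdf G x"
      using le[OF F.real_distribution_axioms G.real_distribution_axioms int_eq, of x]
        le[OF G.real_distribution_axioms F.real_distribution_axioms int_eq[symmetric], of x] by linarith
  qed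
  thus ?thesis by (intro cdf_unique F.real_distribution_axioms G.real_distribution_axioms)
qed

text \<open>The continuity theorem. Behaviour of the limit at \<open>0\<close> gives tightness through the Markov-type
  inequality \<open>P(X > 1/s) (1 - e\<^sup>-\<^sup>1) \<le> 1 - f(s)\<close>, and any weak limit of a subsequence has the limit function as
  its transform.\<close>

lemma is_LST_limit:
  assumes f: "\<And>n. is_LST (f n)" and lim: "\<And>s. 0 \<le> s \<Longrightarrow> (\<lambda>n. f n s) \<longlonglongrightarrow> g s"
    and cont: "(g \<longlongrightarrow> 1) (at_right 0)"
  shows "is_LST g"
proof -
  have "\<forall>n. \<exists>F. nonneg_distribution F \<and> (\<forall>s\<ge>0. f n s = LST F s)"
    using f unfolding is_LST_def by auto
  then obtain F where F: "\<And>n. nonneg_distribution (F n)" and fF: "\<And>n s. 0 \<le> s \<Longrightarrow> f n s = LST (F n) s"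
    by metis
  note F' = nonneg_distributionD[OF F]
  note [measurable_cong] = F'(3)
  interpret F: real_distribution "F n" for n using F' by auto
  have tail: "measure (F n) {x<..} * (1 - exp (- 1)) \<le> 1 - LST (F n) s" if "0 < s" "x = 1 / s" for n s x
  proof -
    have ind: "integrable (F n) (indicat_real {x<..})"
      by (rule F.integrable_const_bound[of _ 1]) auto
    have "(LINT y|F n. indicator {x<..} y * (1 - exp (- 1))) \<le> (LINT y|F n. 1 - exp (- (s * y)))"
    proof (rule integral_mono_AE)
      show "AE y in F n. indicator {x<..} y * (1 - exp (- 1)) \<le> 1 - exp (- (s * y))"
        using F'(5)[of n]
      proof eventually_elim
        case (elim y)
        have "1 \<le> s * y" if "x < y"
          using mult_strict_left_mono[OF that \<open>0 < s\<close>] \<open>0 < s\<close> \<open>x = 1 / s\<close> by auto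
        thus ?case using elim \<open>0 < s\<close> by (auto simp: indicator_def)
      qed
    qed (use ind LST_integrable[OF F, of s n] that in auto)
    thus ?thesis using LST_integrable[OF F, of s n] that unfolding LST_def
      by (auto simp: F.prob_space[simplified])
  qed
  have "tight F"
    unfolding tight_def
  proof (intro conjI allI impI)
    fix e :: real assume "0 < e"
    define d where "d = e / 2 * (1 - exp (- 1))"
    have d: "d > 0" using \<open>0 < e\<close> by (simp add: d_def)
    have "eventually (\<lambda>s. g s > 1 - d / 2) (at_right 0)"
      using order_tendstoD(1)[OF cont, of "1 - d / 2"] d by auto
    hence "eventually (\<lambda>s. g s > 1 - d / 2 \<and> s > 0) (at_right 0)"
      using eventually_at_right_less eventually_conj by auto
    from eventually_happens'[OF trivial_limit_at_right_real this]
    obtain s0 where s0: "s0 > 0" "g s0 > 1 - d / 2" by blast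
    \<comment> \<open>the point \<open>s0\<close> serves all large \<open>n\<close>; the finitely many others each have their own\<close>
    have "eventually (\<lambda>n. f n s0 > 1 - d) sequentially"
      using order_tendstoD(1)[OF lim[of s0], of "1 - d"] s0 d by auto
    then obtain N where N: "\<And>n. n \<ge> N \<Longrightarrow> f n s0 > 1 - d" by (auto simp: eventually_sequentially)
    have "eventually (\<lambda>s. \<forall>n\<in>{..<N}. f n s > 1 - d) (at_right 0)"
      using order_tendstoD(1)[OF is_LST_tendsto_1[OF f], of "1 - d"] d by (intro eventually_ball_finite) auto
    hence "eventually (\<lambda>s. (\<forall>n\<in>{..<N}. f n s > 1 - d) \<and> s > 0) (at_right 0)"
      using eventually_at_right_less eventually_conj by auto
    from eventually_happens'[OF trivial_limit_at_right_real this]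
    obtain s1 where s1: "s1 > 0" "\<And>n. n < N \<Longrightarrow> f n s1 > 1 - d" by blast
    define s where "s = min s0 s1"
    have s: "0 < s" using s0 s1 by (auto simp: s_def)
    have fs: "LST (F n) s > 1 - d" for n
    proof (cases "n < N")
      case True
      thus ?thesis using s1(2)[OF True] fF[of s1 n] s1(1) LST_antimono[OF F, of s s1 n] s by (auto simp: s_def)
    next
      case False
      thus ?thesis using N[of n] fF[of s0 n] s0(1) LST_antimono[OF F, of s s0 n] s by (auto simp: s_def)
    qed
    show "\<exists>a b. a < b \<and> (\<forall>n. 1 - e < measure (F n) {a<..b})"
    proof (intro exI conjI allI)
      show "- 1 < 1 / s" using divide_pos_pos[OF zero_less_one s] by linarith
      fix n
      have m: "measure (F n) {1/s<..} < e / 2 "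
      proof -
        have "measure (F n) {1/s<..} * (1 - exp (- 1)) < e / 2 * (1 - exp (- 1))"
          using tail[OF s refl, of n] fs[of n] unfolding d_def by linarith
        thus ?thesis by (subst (asm) mult_less_cancel_right) auto
      qed
      have "1 = measure (F n) {0..}"
        using F.prob_eq_1[of "{0..}" n] F'(5)[of n] by simp
      also have "\<dots> \<le> measure (F n) ({-1<..1/s} \<union> {1/s<..})"
        by (rule F.finite_measure_mono) auto
      also have "\<dots> \<le> measure (F n) {-1<..1/s} + measure (F n) {1/s<..}"
        by (rule measure_Un_le) auto
      finally show "1 - e < measure (F n) {- 1<..1 / s}" using m \<open>0 < e\<close> by linarith
    qed
  qed (use F' in auto)
  from tight_imp_convergent_subsubsequence[OF this strict_mono_id]
  obtain r G where r: "strict_mono r" and G: "real_distribution G" and w: "weak_conv_m (F \<circ> r) G" by auto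
  note conv = weak_conv_imp_integral_bdd_continuous_conv[OF _ G w, unfolded comp_def, OF F'(1)]
  interpret G: real_distribution G by fact
  have "AE x in G. 0 \<le> x"
  proof -
    \<comment> \<open>a bounded continuous function that is positive exactly on the negative half line\<close>
    define h where "h x = min 1 (max 0 (- x))" for x :: real
    have hm[measurable]: "h \<in> borel_measurable borel" unfolding h_def by measurable
    have "(\<lambda>n. LINT x|F (r n). h x) \<longlonglongrightarrow> (LINT x|G. h x)"
      by (rule conv[of _ 1]) (auto simp: h_def[abs_def] intro!: continuous_intros)
    moreover have "(LINT x|F (r n). h x) = 0" for n
      by (rule integral_eq_zero_AE) (use F'(5)[of "r n"] in \<open>auto elim!: eventually_mono simp: h_def\<close>)
    ultimately have 0: "(LINT x|G. h x) = 0" by (simp add: LIMSEQ_const_iff)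
    have i: "integrable G h" by (rule G.integrable_const_bound[of _ 1]) (auto simp: h_def)
    have "AE x in G. h x = 0"
      using integral_nonneg_eq_0_iff_AE[OF i] 0 by (auto simp: h_def)
    thus ?thesis by eventually_elim (auto simp: h_def min_def max_def split: if_splits)
  qed
  hence nG: "nonneg_distribution G" using G by (simp add: nonneg_distribution_def)
  have "g s = LST G s" if s: "0 \<le> s" for s
  proof -
    have "(\<lambda>n. LINT x|F (r n). exp (- (s * max 0 x))) \<longlonglongrightarrow> (LINT x|G. exp (- (s * max 0 x)))"
      by (rule conv[of _ 1]) (use s in \<open>auto intro!: continuous_intros\<close>)
    moreover have "(LINT x|H. exp (- (s * max 0 x))) = LST H s" if H: "nonneg_distribution H" for H
    proof -
      note [measurable_cong] = nonneg_distributionD(3)[OF H]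
      show ?thesis unfolding LST_def
        by (rule integral_cong_AE) (use nonneg_distributionD(5)[OF H] in \<open>auto elim!: eventually_mono simp del: mult_cancel_left mult_left_cancel simp: max_def\<close>)
    qed
    ultimately have "(\<lambda>n. f (r n) s) \<longlonglongrightarrow> LST G s" using F nG s by (simp add: fF)
    moreover have "(\<lambda>n. f (r n) s) \<longlonglongrightarrow> g s"
      using LIMSEQ_subseq_LIMSEQ[OF lim[OF s] r] by (simp add: comp_def)
    ultimately show ?thesis using LIMSEQ_unique by blast
  qed
  thus ?thesis using nG unfolding is_LST_def by blast
qed

section \<open>Closure properties of the class of transforms\<close>

lemma is_LST_mult:
  assumes "is_LST f" "is_LST g" shows "is_LST (\<lambda>s. f s * g s)"
proof -
  obtain F G where F: "nonneg_distribution F" and f: "\<forall>s\<ge>0. f s = LST F s"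
    and G: "nonneg_distribution G" and g: "\<forall>s\<ge>0. g s = LST G s"
    using assms unfolding is_LST_def by blast
  note [measurable_cong] = nonneg_distributionD(3)[OF F] nonneg_distributionD(3)[OF G]
  interpret F: prob_space F using nonneg_distributionD[OF F] by auto
  interpret G: prob_space G using nonneg_distributionD[OF G] by auto
  interpret P: pair_prob_space F G ..
  have AE: "AE z in F \<Otimes>\<^sub>M G. 0 \<le> fst z \<and> 0 \<le> snd z"
  proof (rule P.AE_pair_measure)
    show "AE x in F. AE y in G. 0 \<le> fst (x, y) \<and> 0 \<le> snd (x, y)"
      using nonneg_distributionD(5)[OF F]
      by eventually_elim (use nonneg_distributionD(5)[OF G] in \<open>auto elim!: eventually_mono\<close>)
  qed auto
  show ?thesis
  proof (rule is_LST_random_variable[of "F \<Otimes>\<^sub>M G" "\<lambda>z. fst z + snd z"])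
    fix s :: real assume s: "0 \<le> s"
    have i: "integrable (F \<Otimes>\<^sub>M G) (\<lambda>z. exp (- (s * fst z)) * exp (- (s * snd z)))"
      by (rule P.integrable_const_bound[of _ 1])
        (use AE in \<open>auto elim!: eventually_mono intro!: mult_le_one mult_nonneg_nonneg s simp del: AE_conj_iff\<close>)
    have "(LINT z|(F \<Otimes>\<^sub>M G). exp (- (s * (fst z + snd z)))) = (LINT z|(F \<Otimes>\<^sub>M G). exp (- (s * fst z)) * exp (- (s * snd z)))"
      by (simp add: exp_add[symmetric] algebra_simps)
    also have "\<dots> = (LINT x|F. LINT y|G. exp (- (s * x)) * exp (- (s * y)))"
      using P.integral_fst'[OF i] by simp
    also have "\<dots> = LST F s * LST G s" by (simp add: LST_def)
    finally show "f s * g s = (LINT z|(F \<Otimes>\<^sub>M G). exp (- (s * (fst z + snd z))))" using f g s by simp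
  qed (use AE in \<open>auto elim!: eventually_mono intro: P.prob_space_axioms simp del: AE_conj_iff\<close>)
qed

lemma is_LST_power: "is_LST f \<Longrightarrow> is_LST (\<lambda>s. f s ^ n)"
proof (induction n)
  case 0 thus ?case using is_LST_exp[of 0] by simp
next
  case (Suc n) thus ?case using is_LST_mult[of f "\<lambda>s. f s ^ n"] by simp
qed

text \<open>For simple \<open>V\<close> the index set carries the discrete \<open>\<sigma>\<close>-algebra, so that choosing a
  distribution for each index is a measurable kernel whatever the choice; the mixture is the bind of
  that kernel.\<close>

lemma is_LST_mixture_simple:
  assumes M: "prob_space M" and V: "simple_function M V" and H: "\<And>v. is_LST (H v)"
  shows "is_LST (\<lambda>s. LINT x|M. H (V x) s)"
proof -
  interpret M: prob_space M by fact
  have "\<forall>v. \<exists>F. nonneg_distribution F \<and> (\<forall>s\<ge>0. H v s = LST F s)"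
    using H unfolding is_LST_def by auto
  then obtain K where K: "\<And>v. nonneg_distribution (K v)" and HK: "\<And>v s. 0 \<le> s \<Longrightarrow> H v s = LST (K v) s"
    by metis
  note K' = nonneg_distributionD[OF K]
  have [measurable]: "V \<in> measurable M (count_space UNIV)"
    using measurable_simple_function[OF V] by simp
  have K_prob: "K \<in> measurable (count_space UNIV) (subprob_algebra borel)"
    using K' by (auto simp: space_subprob_algebra intro: prob_space_imp_subprob_space)
  have KV[measurable]: "(\<lambda>x. K (V x)) \<in> measurable M (subprob_algebra borel)"
    by (rule measurable_compose[OF _ K_prob]) measurable
  let ?B = "M \<bind> (\<lambda>x. K (V x))"
  have sets_B[measurable_cong]: "sets ?B = sets borel"
    by (rule sets_bind_measurable[OF KV]) (rule M.not_empty)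
  interpret B: prob_space ?B
    by (rule M.prob_space_bind[OF _ KV]) (use K' in auto)
  have AE: "AE x in ?B. 0 \<le> x"
    by (subst AE_bind[OF KV]) (use K' in auto)
  have "nonneg_distribution ?B"
    using AE sets_B B.prob_space_axioms by (auto simp: nonneg_distribution_def real_distribution_def real_distribution_axioms_def)
  moreover have "(LINT x|M. H (V x) s) = LST ?B s" if s: "0 \<le> s" for s
  proof -
    have nn: "ennreal (LST F s) = (\<integral>\<^sup>+y. ennreal (exp (- (s * y))) \<partial>F)" if "nonneg_distribution F" for F
      unfolding LST_def by (rule nn_integral_eq_integral[symmetric]) (use LST_integrable[OF that s] in auto)
    have "(\<lambda>x. H (V x) s) \<in> borel_measurable M"
      by (rule measurable_compose[of V _ "count_space UNIV"]) auto
    hence i: "integrable M (\<lambda>x. H (V x) s)"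
      by (rule M.integrable_const_bound[rotated, of _ 1]) (use is_LST_bounds[OF H s] in auto)
    have "ennreal (LST ?B s) = (\<integral>\<^sup>+x. (\<integral>\<^sup>+y. ennreal (exp (- (s * y))) \<partial>K (V x)) \<partial>M)"
      using \<open>nonneg_distribution ?B\<close> by (subst nn) (auto intro!: nn_integral_bind[OF _ KV])
    also have "\<dots> = (\<integral>\<^sup>+x. ennreal (H (V x) s) \<partial>M)"
      by (simp add: nn[OF K] HK s)
    also have "\<dots> = ennreal (LINT x|M. H (V x) s)"
      by (rule nn_integral_eq_integral[OF i]) (use is_LST_bounds[OF H s] in auto)
    finally show ?thesis
      using LST_nonneg[of ?B s] by (subst (asm) ennreal_inj) (auto intro!: integral_nonneg_AE simp: is_LST_bounds[OF H s])
  qed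
  ultimately show ?thesis unfolding is_LST_def by blast
qed

text \<open>Approximation by simple \<open>V\<close> and the continuity theorem avoid the need for a measurable choice of
  the mixed distributions.\<close>

lemma is_LST_mixture:
  fixes V :: "'a \<Rightarrow> 'v :: {metric_space, second_countable_topology}"
  assumes M: "prob_space M" and V[measurable]: "V \<in> borel_measurable M" and H: "\<And>v. is_LST (H v)"
    and cont: "\<And>s. 0 \<le> s \<Longrightarrow> continuous_on UNIV (\<lambda>v. H v s)"
  shows "is_LST (\<lambda>s. LINT x|M. H (V x) s)"
proof -
  interpret M: prob_space M by fact
  obtain S where S: "\<And>i. simple_function M (S i)" "\<And>x. x \<in> space M \<Longrightarrow> (\<lambda>i. S i x) \<longlonglongrightarrow> V x"
    using borel_measurable_implies_sequence_metric[OF V] by blast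
  have m[measurable]: "(\<lambda>v. H v s) \<in> borel_measurable borel" if "0 \<le> s" for s
    using cont[OF that] by (rule borel_measurable_continuous_onI)
  have [measurable]: "S i \<in> borel_measurable M" for i using S(1) by (rule borel_measurable_simple_function)
  show ?thesis
  proof (rule is_LST_limit)
    show "is_LST (\<lambda>s. LINT x|M. H (S n x) s)" for n
      by (rule is_LST_mixture_simple[OF M S(1) H])
    fix s :: real assume s: "0 \<le> s"
    note [measurable] = m[OF s]
    show "(\<lambda>n. LINT x|M. H (S n x) s) \<longlonglongrightarrow> (LINT x|M. H (V x) s)"
    proof (rule integral_dominated_convergence[where w="\<lambda>_. 1"])
      show "AE x in M. (\<lambda>i. H (S i x) s) \<longlonglongrightarrow> H (V x) s"
        using S(2) cont[OF s] by (auto intro!: AE_I2 isCont_tendsto_compose[of _ "\<lambda>v. H v s"] simp: continuous_on_eq_continuous_at)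
    qed (use is_LST_bounds[OF H s] in auto)
  next
    show "((\<lambda>s. LINT x|M. H (V x) s) \<longlongrightarrow> 1) (at_right 0)"
    proof (subst tendsto_at_iff_sequentially, intro allI impI)
      fix X :: "nat \<Rightarrow> real" assume X: "\<forall>i. X i \<in> {0<..} - {0}" "X \<longlonglongrightarrow> 0"
      have X0: "0 \<le> X i" for i using X(1)[rule_format, of i] by auto
      note [measurable] = m[OF X0]
      have "(\<lambda>i. LINT x|M. H (V x) (X i)) \<longlonglongrightarrow> (LINT x|M. 1)"
      proof (rule integral_dominated_convergence[where w="\<lambda>_. 1"])
        have "(\<lambda>i. H v (X i)) \<longlonglongrightarrow> 1" for v
          using is_LST_tendsto_1[OF H[of v], unfolded tendsto_at_iff_sequentially] X by (auto simp: comp_def)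
        thus "AE x in M. (\<lambda>i. H (V x) (X i)) \<longlonglongrightarrow> 1" by simp
      qed (use is_LST_bounds[OF H X0] in auto)
      thus "((\<lambda>s. LINT x|M. H (V x) s) \<circ> X) \<longlonglongrightarrow> 1" by (simp add: comp_def M.prob_space)
    qed
  qed
qed

lemma is_LST_two_point:
  assumes "0 \<le> p" "p \<le> 1" "0 \<le> y"
  shows "is_LST (\<lambda>s. 1 - p + p * exp (- (s * y)))"
  by (rule is_LST_random_variable[of "measure_pmf (bernoulli_pmf p)" "\<lambda>b. if b then y else 0"])
    (use assms in \<open>auto intro: measure_pmf.prob_space_axioms\<close>)

text \<open>The exponential of minus a Bernstein function. Truncate \<open>W\<close> from above at \<open>\<surd>n\<close> and \<open>Y\<close> from
  below at \<open>1/\<surd>n\<close>; then \<open>p = W/(nY)\<close> is at most \<open>1\<close> and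
  \<open>1 - (W/n) (1 - e\<^sup>-\<^sup>s\<^sup>Y)/Y = 1 - p + p e\<^sup>-\<^sup>s\<^sup>Y\<close>
  is the transform of a two-point law. Its mixture has the form \<open>1 - c\<^sub>n(s)/n\<close>, and the \<open>n\<close>-th powers
  converge to the claimed exponential. This approximates the infinitely divisible law by
  sums of independent, mostly vanishing summands.\<close>

lemma is_LST_exp_minus_integral:
  assumes M: "prob_space M" and W: "integrable M W" "AE x in M. 0 \<le> W x"
    and Y[measurable]: "Y \<in> borel_measurable M" "AE x in M. 0 \<le> Y x"
  shows "is_LST (\<lambda>s. exp (- (LINT x|M. W x * exp_primitive (Y x) s)))"
proof -
  interpret M: prob_space M by fact
  have [measurable]: "W \<in> borel_measurable M" using W by auto
  define r where "r n = sqrt (real (Suc n))" for n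
  have r: "r n > 0" "r n * r n = real (Suc n)" "1 \<le> r n" for n by (auto simp: r_def)
  have r_lim: "filterlim r at_top sequentially" unfolding r_def by real_asymp
  define U where "U n x = min (max 0 (W x)) (r n)" for n x
  define Z where "Z n x = max (Y x) (1 / r n)" for n x
  have [measurable]: "U n \<in> borel_measurable M" "Z n \<in> borel_measurable M" for n
    unfolding U_def Z_def by measurable
  have Z: "Z n x > 0" "1 / r n \<le> Z n x" for n x using r(1)[of n] by (auto simp: Z_def max_def intro: less_le_trans[of _ "1 / r n"])
  have U: "0 \<le> U n x" "U n x \<le> r n" "U n x \<le> max 0 (W x)" for n x using r(1)[of n] by (auto simp: U_def)
  have p: "U n x / (real (Suc n) * Z n x) \<le> 1" for n x
  proof -
    have "U n x \<le> r n * r n * (1 / r n)" using U(2)[of n x] r(1)[of n] by simp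
    also have "\<dots> \<le> r n * r n * Z n x" using Z(2)[of n x] r(1)[of n] by (intro mult_left_mono) auto
    finally show ?thesis using Z(1)[of n x] r(2)[of n] by (simp del: of_nat_Suc)
  qed
  have intU: "integrable M (\<lambda>x. U n x * exp_primitive (Z n x) s)" if "0 \<le> s" for n s
    by (rule M.integrable_const_bound[of _ "r n * s"])
      (use r(1)[of n, THEN less_imp_le] U Z exp_primitive_le[of "Z n _" s] exp_primitive_nonneg[of "Z n _" s] that less_imp_le[OF Z(1)] in
       \<open>auto intro!: AE_I2 mult_mono simp: abs_mult\<close>)
  define c where "c n s = (LINT x|M. U n x * exp_primitive (Z n x) s)" for n s
  have g: "is_LST (\<lambda>s. 1 - c n s / real (Suc n))" for n
  proof -
    \<comment> \<open>clipping makes the two-point transform meaningful for every parameter, as a mixture requires\<close>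
    let ?q = "\<lambda>p. max 0 (min 1 p) :: real"
    let ?H = "\<lambda>v s. 1 - ?q (fst v) + ?q (fst v) * exp (- (s * \<bar>snd v\<bar>))"
    have "is_LST (\<lambda>s. LINT x|M. ?H (U n x / (real (Suc n) * Z n x), Z n x) s)"
      by (rule is_LST_mixture[OF M]) (auto intro!: is_LST_two_point continuous_intros)
    moreover have "(LINT x|M. ?H (U n x / (real (Suc n) * Z n x), Z n x) s) = 1 - c n s / real (Suc n)" if "0 \<le> s" for s
    proof -
      have "?H (U n x / (real (Suc n) * Z n x), Z n x) s = 1 - (U n x * exp_primitive (Z n x) s) / real (Suc n)" for x
      proof -
        have "?q (U n x / (real (Suc n) * Z n x)) = U n x / (real (Suc n) * Z n x)"
          using p[of n x] U(1)[of n x] less_imp_le[OF Z(1)[of n x]] by simp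
        thus ?thesis using Z(1)[of n x] by (simp add: exp_primitive_def field_simps del: of_nat_Suc)
      qed
      hence "(LINT x|M. ?H (U n x / (real (Suc n) * Z n x), Z n x) s)
          = (LINT x|M. 1 - (U n x * exp_primitive (Z n x) s) / real (Suc n))"
        by (intro Bochner_Integration.integral_cong refl)
      thus ?thesis using intU[OF that, of n] by (simp add: c_def M.prob_space del: of_nat_Suc)
    qed
    ultimately show ?thesis by (subst (asm) is_LST_cong) auto
  qed
  have int: "integrable M (\<lambda>x. W x * exp_primitive (Y x) s)" if "0 \<le> s" for s
  proof (rule Bochner_Integration.integrable_bound[OF integrable_mult_right[OF W(1), of s]])
    show "AE x in M. norm (W x * exp_primitive (Y x) s) \<le> norm (s * W x)"
      using W(2) Y(2)
    proof eventually_elim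
      case (elim x)
      thus ?case using exp_primitive_nonneg[of "Y x" s] exp_primitive_le[of "Y x" s] that
        by (auto simp: abs_mult mult.commute[of s] intro!: mult_left_mono)
    qed
  qed auto
  show ?thesis
  proof (rule is_LST_limit)
    show "is_LST (\<lambda>s. (1 - c n s / real (Suc n)) ^ Suc n)" for n by (rule is_LST_power[OF g])
    fix s :: real assume s: "0 \<le> s"
    have "(\<lambda>n. c n s) \<longlonglongrightarrow> (LINT x|M. W x * exp_primitive (Y x) s)"
      unfolding c_def
    proof (rule integral_dominated_convergence[where w="\<lambda>x. max 0 (W x) * s"])
      show "AE x in M. (\<lambda>n. U n x * exp_primitive (Z n x) s) \<longlonglongrightarrow> W x * exp_primitive (Y x) s"
        using W(2) Y(2)
      proof eventually_elim
        case (elim x)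
        have "eventually (\<lambda>n. W x \<le> r n) sequentially" using r_lim by (auto simp: filterlim_at_top)
        hence "eventually (\<lambda>n. U n x = W x) sequentially" using elim by (auto elim!: eventually_mono simp: U_def)
        hence 1: "(\<lambda>n. U n x) \<longlonglongrightarrow> W x" by (rule tendsto_eventually)
        have "(\<lambda>n. 1 / r n) \<longlonglongrightarrow> 0" unfolding r_def by real_asymp
        hence "(\<lambda>n. Z n x) \<longlonglongrightarrow> max (Y x) 0" unfolding Z_def by (intro tendsto_intros)
        hence 2: "(\<lambda>n. Z n x) \<longlonglongrightarrow> Y x" using elim by (simp add: max_def)
        show ?case using elim s less_imp_le[OF Z(1)] by (intro tendsto_mult 1 exp_primitive_tendsto 2) auto
      qed
      show "AE x in M. norm (U n x * exp_primitive (Z n x) s) \<le> max 0 (W x) * s" for n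
      proof (rule AE_I2)
        fix x
        have "U n x * exp_primitive (Z n x) s \<le> max 0 (W x) * s"
          by (intro mult_mono U exp_primitive_le exp_primitive_nonneg less_imp_le[OF Z(1)] s) auto
        moreover have "0 \<le> U n x * exp_primitive (Z n x) s"
          by (intro mult_nonneg_nonneg U exp_primitive_nonneg less_imp_le[OF Z(1)] s)
        ultimately show "norm (U n x * exp_primitive (Z n x) s) \<le> max 0 (W x) * s" by simp
      qed
    qed (use W in auto)
    moreover have "0 \<le> c n s" for n unfolding c_def
      by (intro integral_nonneg_AE AE_I2 mult_nonneg_nonneg U exp_primitive_nonneg less_imp_le[OF Z(1)] s)
    moreover have "c n s \<le> real (Suc n)" for n
      using is_LST_bounds(1)[OF g s, of n] by (simp add: divide_le_eq del: of_nat_Suc)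
    ultimately show "(\<lambda>n. (1 - c n s / real (Suc n)) ^ Suc n) \<longlonglongrightarrow> exp (- (LINT x|M. W x * exp_primitive (Y x) s))"
      by (intro exp_limit_perturbed)
  next
    have "((\<lambda>s. LINT x|M. W x * exp_primitive (Y x) s) \<longlongrightarrow> 0) (at_right 0)"
    proof (rule Lim_null_comparison)
      have "((\<lambda>s. (LINT x|M. W x) * s) \<longlongrightarrow> (LINT x|M. W x) * 0) (at_right 0)"
        by (intro tendsto_intros)
      thus "((\<lambda>s. (LINT x|M. W x) * s) \<longlongrightarrow> 0) (at_right 0)" by simp
      show "\<forall>\<^sub>F s in at_right 0. norm (LINT x|M. W x * exp_primitive (Y x) s) \<le> (LINT x|M. W x) * s"
        using eventually_at_right_less[of "0::real"]
      proof eventually_elim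
        case (elim s)
        have "0 \<le> (LINT x|M. W x * exp_primitive (Y x) s)"
          by (rule integral_nonneg_AE, use W(2) Y(2) in eventually_elim) (use elim in \<open>auto intro!: mult_nonneg_nonneg exp_primitive_nonneg\<close>)
        moreover have "(LINT x|M. W x * exp_primitive (Y x) s) \<le> (LINT x|M. W x * s)"
        proof (rule integral_mono_AE)
          show "AE x in M. W x * exp_primitive (Y x) s \<le> W x * s"
            using W(2) Y(2) by eventually_elim (auto intro!: mult_left_mono exp_primitive_le)
        qed (use W elim int in auto)
        ultimately show ?case by simp
      qed
    qed
    from tendsto_exp[OF tendsto_minus[OF this]]
    show "((\<lambda>s. exp (- (LINT x|M. W x * exp_primitive (Y x) s))) \<longlongrightarrow> 1) (at_right 0)" by simp
  qed
qed

text \<open>Subordination: if \<open>f\<close> is the transform of \<open>Y\<close>, then \<open>f \<circ> \<psi>\<close> is the mixture of the transforms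
  \<open>e\<^sup>-\<^sup>Y\<^sup>\<psi>\<close>.\<close>

lemma is_LST_compose:
  assumes f: "is_LST f" and psi: "\<And>c. 0 \<le> c \<Longrightarrow> is_LST (\<lambda>s. exp (- (c * \<psi> s)))"
  shows "is_LST (\<lambda>s. f (\<psi> s))"
proof -
  obtain F where F: "nonneg_distribution F" and fF: "\<forall>s\<ge>0. f s = LST F s" using f unfolding is_LST_def by auto
  note F' = nonneg_distributionD[OF F]
  note [measurable_cong] = F'(3)
  have psi0: "0 \<le> \<psi> s" if "0 \<le> s" for s using is_LST_bounds(2)[OF psi[of 1] that] by simp
  have "is_LST (\<lambda>s. LINT y|F. exp (- (\<bar>y\<bar> * \<psi> s)))"
    by (rule is_LST_mixture[OF F'(2), of "\<lambda>y. y"]) (auto intro!: psi continuous_intros)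
  moreover have "(LINT y|F. exp (- (\<bar>y\<bar> * \<psi> s))) = LST F (\<psi> s)" for s
    unfolding LST_def
    by (rule integral_cong_AE) (use F'(5) in \<open>auto elim!: eventually_mono simp: mult.commute simp del: mult_cancel_left mult_cancel_right\<close>)
  ultimately show ?thesis using fF psi0 by (subst is_LST_cong[of _ "\<lambda>s. LINT y|F. exp (- (\<bar>y\<bar> * \<psi> s))"]) auto
qed

text \<open>The transform of a gamma distribution, obtained as \<open>exp (- a ln(1 + s))\<close>: the logarithm is the
  primitive of \<open>1/(1 + s)\<close>, the transform of the standard exponential distribution.\<close>

lemma is_LST_one_plus_powr:
  assumes a: "0 \<le> a"
  shows "is_LST (\<lambda>s. (1 + s) powr (- a))"
proof -
  define E where "E = density lborel (\<lambda>x. ennreal (exponential_density 1 x))"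
  interpret E: prob_space E unfolding E_def by (rule prob_space_exponential_density) simp
  have AE: "AE x in E. 0 \<le> x"
    using AE_density[of "\<lambda>x. ennreal (exponential_density 1 x)" lborel "\<lambda>x. 0 \<le> x"]
    unfolding E_def by (auto simp: exponential_density_def)
  have [measurable_cong]: "sets E = sets borel" by (simp add: E_def)
  hence nE: "nonneg_distribution E"
    using AE E.prob_space_axioms by (simp add: nonneg_distribution_def real_distribution_def real_distribution_axioms_def)
  have L: "LST E s = 1 / (1 + s)" if s: "0 \<le> s" for s
  proof -
    interpret P: prob_space "density lborel (\<lambda>x. ennreal (exponential_density (1 + s) x))"
      by (rule prob_space_exponential_density) (use s in auto)
    have "(1::real) = (LINT x|density lborel (\<lambda>x. ennreal (exponential_density (1 + s) x)). 1)"
      using P.prob_space by simp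
    also have "\<dots> = (LINT x|lborel. exponential_density (1 + s) x)"
      by (subst integral_density) (use exponential_density_nonneg[of "1 + s"] s in auto)
    also have "\<dots> = (LINT x|lborel. (1 + s) * (exponential_density 1 x * exp (- (s * x))))"
      by (rule Bochner_Integration.integral_cong) (auto simp: exponential_density_def exp_add[symmetric] algebra_simps)
    also have "\<dots> = (1 + s) * LST E s"
      unfolding LST_def E_def by (subst integral_density) (use exponential_density_nonneg[of 1] in auto)
    finally show ?thesis using s by (simp add: field_simps)
  qed
  have K: "(LINT y|E. exp_primitive y s) = ln (1 + s)" if s: "0 \<le> s" for s
  proof -
    have "((\<lambda>x. 1 / (1 + x)) has_integral (ln (1 + s) - ln (1 + 0))) {0..s}"
      by (rule fundamental_theorem_of_calculus[OF s])
        (auto simp: has_real_derivative_iff_has_vector_derivative[symmetric] intro!: derivative_eq_intros)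
    moreover have "set_integrable lborel {0..s} (\<lambda>x. 1 / (1 + x))"
      by (rule borel_integrable_atLeastAtMost') (auto intro!: continuous_intros)
    ultimately have "(LBINT x:{0..s}. 1 / (1 + x)) = ln (1 + s)"
      by (simp add: set_borel_integral_eq_integral integral_unique)
    moreover have "(LBINT x:{0..s}. LST E x) = (LBINT x:{0..s}. 1 / (1 + x))"
      by (rule set_lebesgue_integral_cong) (auto simp: L)
    ultimately show ?thesis using LST_integral[OF nE s] by simp
  qed
  have "is_LST (\<lambda>s. exp (- (LINT y|E. a * exp_primitive y s)))"
    by (rule is_LST_exp_minus_integral[OF E.prob_space_axioms]) (use a AE in auto)
  thus ?thesis
    by (rule is_LST_cong[THEN iffD1, rotated]) (auto simp: K powr_def)
qed

section \<open>Moments read off from the transform\<close>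

text \<open>The class of distributions that the iteration stays in.\<close>

definition moments_below :: "real \<Rightarrow> real \<Rightarrow> real measure \<Rightarrow> bool" where
  "moments_below \<mu> m F \<longleftrightarrow> nonneg_distribution F \<and> has_mean F \<mu> \<and>
     integrable F (\<lambda>x. x\<^sup>2) \<and> (LINT x|F. x\<^sup>2) \<le> m"

lemma LST_remainder:
  assumes F: "nonneg_distribution F" and mean: "has_mean F \<mu>" and s: "0 \<le> s"
  shows "LST F s - 1 + \<mu> * s = (LINT x|F. exp (- (s * x)) - 1 + s * x)"
    "integrable F (\<lambda>x. exp (- (s * x)) - 1 + s * x)"
proof -
  interpret prob_space F using nonneg_distributionD[OF F] by auto
  have i: "integrable F (\<lambda>x. x)" "(LINT x|F. x) = \<mu>" using mean by (auto simp: has_mean_def mean_def)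
  show "integrable F (\<lambda>x. exp (- (s * x)) - 1 + s * x)"
    using i LST_integrable[OF F s] by auto
  show "LST F s - 1 + \<mu> * s = (LINT x|F. exp (- (s * x)) - 1 + s * x)"
    using i LST_integrable[OF F s] by (simp add: LST_def prob_space)
qed

lemma LST_lower:
  assumes F: "nonneg_distribution F" and mean: "has_mean F \<mu>" and s: "0 \<le> s"
  shows "1 - \<mu> * s \<le> LST F s"
proof -
  have "0 \<le> (LINT x|F. exp (- (s * x)) - 1 + s * x)"
  proof (rule integral_nonneg_AE, rule AE_I2)
    fix x show "0 \<le> exp (- (s * x)) - 1 + s * x" using exp_ge_add_one_self[of "- (s * x)"] by linarith
  qed
  thus ?thesis using LST_remainder(1)[OF assms] by simp
qed

lemma LST_upper:
  assumes F: "moments_below \<mu> m F" and s: "0 \<le> s"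
  shows "LST F s \<le> 1 - \<mu> * s + m / 2 * s\<^sup>2"
proof -
  note F' = F[unfolded moments_below_def]
  have "(LINT x|F. exp (- (s * x)) - 1 + s * x) \<le> (LINT x|F. s\<^sup>2 / 2 * x\<^sup>2)"
  proof (rule integral_mono_AE)
    show "AE x in F. exp (- (s * x)) - 1 + s * x \<le> s\<^sup>2 / 2 * x\<^sup>2"
      using nonneg_distributionD(5)[OF F'[THEN conjunct1]]
    proof eventually_elim
      case (elim x)
      show ?case using exp_minus_le_quadratic[OF mult_nonneg_nonneg[OF s elim]] by (simp add: power_mult_distrib)
    qed
  qed (use F' LST_remainder(2)[OF _ _ s] in auto)
  also have "\<dots> \<le> s\<^sup>2 / 2 * m" using F' by (simp add: mult_left_mono)
  finally show ?thesis using LST_remainder(1)[OF _ _ s, of F \<mu>] F' by (simp add: mult.commute)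
qed

lemma LST_diff_quadratic:
  assumes "moments_below \<mu> m F" "moments_below \<mu> m G" "0 \<le> s"
  shows "\<bar>LST F s - LST G s\<bar> \<le> m / 2 * s\<^sup>2"
  using LST_upper[OF assms(1,3)] LST_upper[OF assms(2,3)]
    LST_lower[OF _ _ assms(3), of F \<mu>] LST_lower[OF _ _ assms(3), of G \<mu>] assms(1,2)
  unfolding moments_below_def by linarith

lemma LST_remainder_limit:
  assumes F: "nonneg_distribution F" and mean: "has_mean F \<mu>"
    and u: "u \<longlonglongrightarrow> 0" "\<And>n. 0 < u n" and bnd: "\<And>n. (LST F (u n) - 1 + \<mu> * u n) / (u n)\<^sup>2 \<le> K"
  shows "integrable F (\<lambda>x. x\<^sup>2)" "(\<lambda>n. (LST F (u n) - 1 + \<mu> * u n) / (u n)\<^sup>2) \<longlonglongrightarrow> (LINT x|F. x\<^sup>2) / 2"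
proof -
  note F' = nonneg_distributionD[OF F]
  note [measurable_cong] = F'(3)
  let ?h = "\<lambda>n x. (exp (- (u n * x)) - 1 + u n * x) / (u n)\<^sup>2"
  have eq: "(LST F (u n) - 1 + \<mu> * u n) / (u n)\<^sup>2 = (LINT x|F. ?h n x)" for n
    using LST_remainder(1)[OF F mean, of "u n"] u(2)[of n] by simp
  have "integrable F (\<lambda>x. x\<^sup>2 / 2) \<and> (\<lambda>n. LINT x|F. ?h n x) \<longlonglongrightarrow> (LINT x|F. x\<^sup>2 / 2)"
  proof (rule convergence_below_limit[where K=K])
    show "integrable F (?h n)" for n using LST_remainder(2)[OF F mean, of "u n"] u(2)[of n] by auto
    show "AE x in F. 0 \<le> ?h n x \<and> ?h n x \<le> x\<^sup>2 / 2" for n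
      using F'(5)
    proof eventually_elim
      case (elim x)
      have "exp (- (u n * x)) - 1 + u n * x \<le> x\<^sup>2 / 2 * (u n)\<^sup>2"
        using exp_minus_le_quadratic[of "u n * x"] elim u(2)[of n] by (simp add: power_mult_distrib mult.commute)
      moreover have "0 \<le> exp (- (u n * x)) - 1 + u n * x" using exp_ge_add_one_self[of "- (u n * x)"] by linarith
      ultimately show ?case using u(2)[of n] by (simp add: divide_le_eq)
    qed
    show "AE x in F. (\<lambda>n. ?h n x) \<longlonglongrightarrow> x\<^sup>2 / 2"
      using F'(5) by eventually_elim (rule exp_remainder_scaled_limit[OF _ u])
    show "(LINT x|F. ?h n x) \<le> K" for n using bnd[of n] eq by simp
  qed auto
  hence *: "integrable F (\<lambda>x. x\<^sup>2 / 2)" "(\<lambda>n. LINT x|F. ?h n x) \<longlonglongrightarrow> (LINT x|F. x\<^sup>2 / 2)" by auto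
  from *(1) have "integrable F (\<lambda>x. 2 * (x\<^sup>2 / 2))" by (rule integrable_mult_right)
  thus "integrable F (\<lambda>x. x\<^sup>2)" by simp
  show "(\<lambda>n. (LST F (u n) - 1 + \<mu> * u n) / (u n)\<^sup>2) \<longlonglongrightarrow> (LINT x|F. x\<^sup>2) / 2"
    unfolding eq using *(2) by simp
qed

text \<open>The quotients \<open>(1 - e\<^sup>-\<^sup>s\<^sup>x)/s\<close> and \<open>(e\<^sup>-\<^sup>s\<^sup>x - 1 + sx)/s\<^sup>2\<close> increase to \<open>x\<close> and \<open>x\<^sup>2/2\<close> as \<open>s\<close> decreases to
  \<open>0\<close>, so the bounds on the transform control both moments. Being a condition on the
  transform alone, this characterization survives pointwise limits.\<close>

lemma moments_below_of_LST_bounds: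
  assumes F: "nonneg_distribution F"
    and lo: "\<And>s. 0 \<le> s \<Longrightarrow> 1 - \<mu> * s \<le> LST F s"
    and hi: "\<And>s. 0 \<le> s \<Longrightarrow> LST F s \<le> 1 - \<mu> * s + m / 2 * s\<^sup>2"
  shows "moments_below \<mu> m F"
proof -
  note F' = nonneg_distributionD[OF F]
  note [measurable_cong] = F'(3)
  interpret prob_space F by (rule F')
  define u where "u n = 1 / real (Suc n)" for n
  have u: "u \<longlonglongrightarrow> 0" "0 < u n" for n
    unfolding u_def using LIMSEQ_inverse_real_of_nat by (auto simp: inverse_eq_divide)
  have eq: "(1 - LST F (u n)) / u n = (LINT x|F. exp_primitive (u n) x)" for n
  proof -
    have "exp_primitive (u n) x = (1 - exp (- (u n * x))) / u n" for x
      using u(2)[of n] by (simp add: exp_primitive_def mult.commute)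
    thus ?thesis using LST_integrable[OF F, of "u n"] u(2)[of n] by (simp add: LST_def prob_space)
  qed
  have *: "integrable F (\<lambda>x. x) \<and> (\<lambda>n. LINT x|F. exp_primitive (u n) x) \<longlonglongrightarrow> (LINT x|F. x)"
  proof (rule convergence_below_limit[where K=\<mu>])
    show "integrable F (exp_primitive (u n))" for n
    proof -
      have "exp_primitive (u n) = (\<lambda>x. (1 - exp (- (u n * x))) / u n)"
        using u(2)[of n] by (auto simp: exp_primitive_def mult.commute)
      thus ?thesis using LST_integrable[OF F, of "u n"] u(2)[of n] by auto
    qed
    show "AE x in F. 0 \<le> exp_primitive (u n) x \<and> exp_primitive (u n) x \<le> x" for n
      using F'(5) by eventually_elim (use u(2)[of n] in \<open>auto intro!: exp_primitive_nonneg exp_primitive_le\<close>)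
    show "AE x in F. (\<lambda>n. exp_primitive (u n) x) \<longlonglongrightarrow> x"
      using F'(5)
    proof eventually_elim
      case (elim x)
      have "(\<lambda>n. exp_primitive (u n) x) \<longlonglongrightarrow> exp_primitive 0 x" by (rule exp_primitive_tendsto) (use elim u in \<open>auto intro: less_imp_le\<close>)
      thus ?case by (simp add: exp_primitive_def)
    qed
    show "(LINT x|F. exp_primitive (u n) x) \<le> \<mu>" for n
      using lo[of "u n"] u(2)[of n] unfolding eq[symmetric] by (simp add: divide_le_eq)
  qed auto
  have "(\<lambda>n. LINT x|F. exp_primitive (u n) x) \<longlonglongrightarrow> \<mu>"
  proof (rule tendsto_sandwich)
    have "(\<lambda>n. \<mu> - m / 2 * u n) \<longlonglongrightarrow> \<mu> - m / 2 * 0" by (intro tendsto_intros u)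
    thus "(\<lambda>n. \<mu> - m / 2 * u n) \<longlonglongrightarrow> \<mu>" by simp
    show "\<forall>\<^sub>F n in sequentially. \<mu> - m / 2 * u n \<le> (LINT x|F. exp_primitive (u n) x)"
      unfolding eq[symmetric]
    proof (intro always_eventually allI)
      fix n
      have "(\<mu> - m / 2 * u n) * u n \<le> 1 - LST F (u n)"
        using hi[of "u n"] u(2)[of n] by (simp add: algebra_simps power2_eq_square)
      thus "\<mu> - m / 2 * u n \<le> (1 - LST F (u n)) / u n" using u(2)[of n] by (simp add: le_divide_eq)
    qed
    show "\<forall>\<^sub>F n in sequentially. (LINT x|F. exp_primitive (u n) x) \<le> \<mu>"
      unfolding eq[symmetric] using lo[of "u _"] u(2) by (intro always_eventually) (simp add: divide_le_eq algebra_simps less_imp_le)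
  qed simp
  hence mean: "has_mean F \<mu>" using * LIMSEQ_unique[OF conjunct2[OF *]] by (auto simp: has_mean_def mean_def)
  have bnd: "(LST F (u n) - 1 + \<mu> * u n) / (u n)\<^sup>2 \<le> m / 2" for n
    using hi[of "u n"] u(2)[of n] by (simp add: divide_le_eq)
  note lim = LST_remainder_limit[OF F mean u bnd]
  have "(LINT x|F. x\<^sup>2) / 2 \<le> m / 2" by (rule LIMSEQ_le_const2[OF lim(2)]) (use bnd in auto)
  thus ?thesis using F mean lim(1) by (simp add: moments_below_def)
qed

lemma finite_variance_iff:
  assumes F: "nonneg_distribution F" and mean: "has_mean F \<mu>"
  shows "finite_variance F \<longleftrightarrow> integrable F (\<lambda>x. x\<^sup>2)"
proof -
  interpret prob_space F using nonneg_distributionD[OF F] by auto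
  have i: "integrable F (\<lambda>x. x)" "mean F = \<mu>" using mean by (auto simp: has_mean_def)
  have j: "integrable F (\<lambda>x. 2 * \<mu> * x - \<mu>\<^sup>2)" using i by auto
  have "(\<lambda>x. x\<^sup>2) = (\<lambda>x. (x - mean F)\<^sup>2 + (2 * \<mu> * x - \<mu>\<^sup>2))"
    by (simp add: i(2) power2_eq_square algebra_simps)
  moreover have "(\<lambda>x. (x - mean F)\<^sup>2) = (\<lambda>x. x\<^sup>2 - (2 * \<mu> * x - \<mu>\<^sup>2))"
    by (simp add: i(2) power2_eq_square algebra_simps)
  ultimately show ?thesis
    unfolding finite_variance_def
    using Bochner_Integration.integrable_add[OF _ j, of "\<lambda>x. (x - mean F)\<^sup>2"]
      Bochner_Integration.integrable_diff[OF _ j, of "\<lambda>x. x\<^sup>2"] by metis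
qed

section \<open>The equation as a fixed point problem\<close>

definition sigma_integrand :: "real measure \<Rightarrow> real \<Rightarrow> real \<Rightarrow> real" where
  "sigma_integrand F t s = (if t = 0 then mean F * s else (1 - LST F (t * s)) / t)"

lemma measurable_sigma_integrand [measurable]:
  assumes "nonneg_distribution F"
  shows "(\<lambda>t. sigma_integrand F t s) \<in> borel_measurable borel"
proof -
  note [measurable] = measurable_LST[OF assms]
  show ?thesis unfolding sigma_integrand_def by measurable
qed

text \<open>This form exhibits \<open>\<sigma>\<close> as an expectation of \<open>X exp_primitive(TX, s)\<close> with independent \<open>X\<close> and \<open>T\<close>,
  which includes the value at \<open>t = 0\<close> without a case distinction.\<close>

lemma sigma_integrand_eq_integral:
  assumes F: "nonneg_distribution F" and mean: "has_mean F \<mu>" and t: "0 \<le> t" and s: "0 \<le> s"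
  shows "sigma_integrand F t s = (LINT x|F. x * exp_primitive (t * x) s)"
proof (cases "t = 0")
  case True
  thus ?thesis by (simp add: sigma_integrand_def mean_def exp_primitive_def)
next
  case False
  interpret prob_space F using nonneg_distributionD[OF F] by auto
  have "x * exp_primitive (t * x) s = (1 - exp (- (t * s * x))) / t" for x
    using False by (simp add: exp_primitive_def mult_ac)
  thus ?thesis using False LST_integrable[OF F, of "t * s"] s t
    by (simp add: sigma_integrand_def LST_def prob_space)
qed

lemma sigma_integrand_bounds:
  assumes F: "nonneg_distribution F" and mean: "has_mean F \<mu>" and t: "0 \<le> t" and s: "0 \<le> s"
  shows "0 \<le> sigma_integrand F t s" "sigma_integrand F t s \<le> \<mu> * s"
  using LST_le_1[OF F, of "t * s"] LST_lower[OF F mean, of "t * s"] mean t s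
    integral_nonneg_AE[of "\<lambda>x. x" F] nonneg_distributionD(5)[OF F]
  by (auto simp: sigma_integrand_def has_mean_def mean_def divide_le_eq algebra_simps)

lemma sigma_integrand_lower:
  assumes F: "moments_below \<mu> m F" and t: "0 \<le> t" and s: "0 \<le> s"
  shows "\<mu> * s - sigma_integrand F t s \<le> t * m / 2 * s\<^sup>2"
proof (cases "t = 0")
  case True
  thus ?thesis using F by (simp add: sigma_integrand_def moments_below_def has_mean_def)
next
  case False
  have "(1 - LST F (t * s)) / t \<ge> (\<mu> * (t * s) - m / 2 * (t * s)\<^sup>2) / t"
    using LST_upper[OF F, of "t * s"] t s by (intro divide_right_mono) auto
  moreover have "(\<mu> * (t * s) - m / 2 * (t * s)\<^sup>2) / t = \<mu> * s - t * m / 2 * s\<^sup>2"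
    using False by (simp add: field_simps power2_eq_square)
  moreover have "sigma_integrand F t s = (1 - LST F (t * s)) / t" using False by (simp add: sigma_integrand_def)
  ultimately show ?thesis by linarith
qed

lemma sigma_integrand_remainder_limit:
  assumes F: "nonneg_distribution F" and mean: "has_mean F \<mu>" and sq: "integrable F (\<lambda>x. x\<^sup>2)"
    and t: "0 \<le> t" and u: "u \<longlonglongrightarrow> 0" "\<And>n. 0 < u n"
  shows "(\<lambda>n. (\<mu> * u n - sigma_integrand F t (u n)) / (u n)\<^sup>2) \<longlonglongrightarrow> t * (LINT x|F. x\<^sup>2) / 2"
proof (cases "t = 0")
  case True
  thus ?thesis using mean by (simp add: sigma_integrand_def has_mean_def)
next
  case False
  let ?m = "LINT x|F. x\<^sup>2"
  have mb: "moments_below \<mu> ?m F" using F mean sq by (simp add: moments_below_def)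
  have lim: "(\<lambda>n. (LST F (t * u n) - 1 + \<mu> * (t * u n)) / (t * u n)\<^sup>2) \<longlonglongrightarrow> ?m / 2"
  proof (rule LST_remainder_limit(2)[OF F mean, where K="?m / 2"])
    have "(\<lambda>n. t * u n) \<longlonglongrightarrow> t * 0" by (intro tendsto_intros u)
    thus "(\<lambda>n. t * u n) \<longlonglongrightarrow> 0" by simp
    show pos: "0 < t * u n" for n using False t u(2)[of n] by simp
    show "(LST F (t * u n) - 1 + \<mu> * (t * u n)) / (t * u n)\<^sup>2 \<le> ?m / 2" for n
    proof -
      have "LST F (t * u n) - 1 + \<mu> * (t * u n) \<le> ?m / 2 * (t * u n)\<^sup>2"
        using LST_upper[OF mb, of "t * u n"] pos[of n] by linarith
      thus ?thesis using pos[of n] by (subst divide_le_eq) (auto simp: zero_less_power)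
    qed
  qed
  have "(\<mu> * u n - sigma_integrand F t (u n)) / (u n)\<^sup>2 = t * ((LST F (t * u n) - 1 + \<mu> * (t * u n)) / (t * u n)\<^sup>2)" for n
    using False u(2)[of n] by (simp add: sigma_integrand_def field_simps power2_eq_square)
  thus ?thesis using tendsto_mult_left[OF lim, of t] by simp
qed

locale equation_data = prob_space M for M :: "'a measure" +
  fixes T A L B :: "'a \<Rightarrow> real"
  assumes T[measurable]: "T \<in> borel_measurable M" and A[measurable]: "A \<in> borel_measurable M"
    and L[measurable]: "L \<in> borel_measurable M" and B[measurable]: "B \<in> borel_measurable M"
    and T_nonneg: "AE \<omega> in M. 0 \<le> T \<omega>" and A_nonneg: "AE \<omega> in M. 0 \<le> A \<omega>"
    and L_nonneg: "AE \<omega> in M. 0 \<le> L \<omega>" and B_nonneg: "AE \<omega> in M. 0 \<le> B \<omega>"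
    and indep: "indep_var borel A borel L"
begin

definition phi :: "real \<Rightarrow> real" where
  "phi u = expectation (\<lambda>\<omega>. (1 + L \<omega> * u) powr (- A \<omega>))"

text \<open>The functions \<open>\<sigma>\<^sub>B\<close> and \<open>\<sigma>\<close> as expectations over the common probability space.\<close>

definition sigB :: "real \<Rightarrow> real" where
  "sigB x = expectation (\<lambda>\<omega>. exp_primitive (B \<omega>) x)"

definition sig :: "real measure \<Rightarrow> real \<Rightarrow> real" where
  "sig F s = expectation (\<lambda>\<omega>. sigma_integrand F (T \<omega>) s)"

text \<open>The right side of the equation as a map on distributions; solutions are its fixed points.\<close>

definition equation_rhs :: "real measure \<Rightarrow> real \<Rightarrow> real" where
  "equation_rhs F s = phi (sigB (sig F s))"

lemma phi_integrable: "0 \<le> u \<Longrightarrow> integrable M (\<lambda>\<omega>. (1 + L \<omega> * u) powr (- A \<omega>))"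
proof (rule integrable_const_bound[of _ 1])
  assume u: "0 \<le> u"
  show "AE \<omega> in M. norm ((1 + L \<omega> * u) powr (- A \<omega>)) \<le> 1"
    using A_nonneg L_nonneg
  proof eventually_elim
    case (elim \<omega>)
    thus ?case using one_plus_powr_diff(1)[of "L \<omega>" "A \<omega>" 0 u] u by simp
  qed
qed measurable

lemma sigB_integrable: "0 \<le> x \<Longrightarrow> integrable M (\<lambda>\<omega>. exp_primitive (B \<omega>) x)"
proof (rule integrable_const_bound[of _ x])
  assume x: "0 \<le> x"
  show "AE \<omega> in M. norm (exp_primitive (B \<omega>) x) \<le> x"
    using B_nonneg by eventually_elim (use exp_primitive_nonneg exp_primitive_le x in auto)
qed measurable

lemma sig_integrable:
  assumes F: "nonneg_distribution F" and mean: "has_mean F \<mu>" and s: "0 \<le> s"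
  shows "integrable M (\<lambda>\<omega>. sigma_integrand F (T \<omega>) s)"
proof (rule integrable_const_bound[of _ "\<mu> * s"])
  note [measurable] = measurable_sigma_integrand[OF F]
  show "AE \<omega> in M. norm (sigma_integrand F (T \<omega>) s) \<le> \<mu> * s"
    using T_nonneg by eventually_elim (use sigma_integrand_bounds[OF F mean _ s] in auto)
  show "(\<lambda>\<omega>. sigma_integrand F (T \<omega>) s) \<in> borel_measurable M" by measurable
qed

lemma sig_bounds:
  assumes F: "nonneg_distribution F" and mean: "has_mean F \<mu>" and s: "0 \<le> s"
  shows "0 \<le> sig F s" "sig F s \<le> \<mu> * s"
proof -
  show "0 \<le> sig F s" unfolding sig_def
    by (rule integral_nonneg_AE) (use T_nonneg in \<open>auto elim!: eventually_mono intro: sigma_integrand_bounds[OF F mean _ s]\<close>)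
  have "sig F s \<le> expectation (\<lambda>\<omega>. \<mu> * s)" unfolding sig_def
    by (rule integral_mono_AE[OF sig_integrable[OF F mean s]])
      (use T_nonneg in \<open>auto elim!: eventually_mono intro: sigma_integrand_bounds[OF F mean _ s]\<close>)
  thus "sig F s \<le> \<mu> * s" by (simp add: prob_space)
qed

lemma sigB_diff:
  assumes "0 \<le> x" "x \<le> y"
  shows "0 \<le> sigB y - sigB x" "sigB y - sigB x \<le> y - x"
proof -
  have i: "integrable M (\<lambda>\<omega>. exp_primitive (B \<omega>) x)" "integrable M (\<lambda>\<omega>. exp_primitive (B \<omega>) y)"
    using sigB_integrable assms by auto
  have eq: "sigB y - sigB x = expectation (\<lambda>\<omega>. exp_primitive (B \<omega>) y - exp_primitive (B \<omega>) x)"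
    using i by (simp add: sigB_def)
  show "0 \<le> sigB y - sigB x" unfolding eq
    by (rule integral_nonneg_AE) (use B_nonneg in \<open>auto elim!: eventually_mono dest: exp_primitive_diff(1)[OF _ assms]\<close>)
  have "expectation (\<lambda>\<omega>. exp_primitive (B \<omega>) y - exp_primitive (B \<omega>) x) \<le> expectation (\<lambda>\<omega>. y - x)"
    by (rule integral_mono_AE) (use i B_nonneg in \<open>auto elim!: eventually_mono dest: exp_primitive_diff(2)[OF _ assms]\<close>)
  thus "sigB y - sigB x \<le> y - x" unfolding eq by (simp add: prob_space)
qed

lemma sigB_bounds:
  assumes "0 \<le> x" shows "0 \<le> sigB x" "sigB x \<le> x"
  using sigB_diff[of 0 x] assms by (auto simp: sigB_def)

text \<open>Independence of \<open>A\<close> and \<open>L\<close> turns the iterated integral into a single expectation.\<close>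

lemma satisfies_equation_iff:
  assumes F: "nonneg_distribution F" and mean: "has_mean F \<mu>"
  shows "satisfies_equation (distr M borel T) (distr M borel A) (distr M borel L) (distr M borel B) F
    \<longleftrightarrow> (\<forall>s\<ge>0. LST F s = equation_rhs F s)"
proof -
  let ?A = "distr M borel A" and ?L = "distr M borel L"
  interpret A: prob_space ?A by (rule prob_space_distr) measurable
  interpret L: prob_space ?L by (rule prob_space_distr) measurable
  interpret P: pair_prob_space ?A ?L ..
  have AL: "?A \<Otimes>\<^sub>M ?L = distr M (borel \<Otimes>\<^sub>M borel) (\<lambda>\<omega>. (A \<omega>, L \<omega>))"
    using indep indep_var_distribution_eq by blast
  have nB: "nonneg_distribution (distr M borel B)"
    by (rule nonneg_distribution_distr[OF prob_space_axioms B B_nonneg])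
  note [measurable] = measurable_sigma_integrand[OF F]
  have sT: "sigma_T (distr M borel T) F s = sig F s" for s
    unfolding sigma_T_def sig_def sigma_integrand_def[symmetric] by (subst integral_distr) auto
  have sB: "sigma_B (distr M borel B) x = sigB x" if "0 \<le> x" for x
    unfolding sigma_B_def sigB_def LST_integral[OF nB that] by (subst integral_distr) auto
  have ph: "(LINT l|?L. (LINT a|?A. (1 + l * u) powr (- a))) = phi u" if u: "0 \<le> u" for u
  proof -
    have m: "(\<lambda>z. (1 + snd z * u) powr (- fst z)) \<in> borel_measurable (borel \<Otimes>\<^sub>M borel)"
      by measurable
    have "integrable (?A \<Otimes>\<^sub>M ?L) (\<lambda>(a, l). (1 + l * u) powr (- a))"
      unfolding AL using phi_integrable[OF u] m by (subst integrable_distr_eq) (auto simp: case_prod_beta)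
    from P.integral_snd[OF this]
    have "(LINT l|?L. (LINT a|?A. (1 + l * u) powr (- a))) = integral\<^sup>L (?A \<Otimes>\<^sub>M ?L) (\<lambda>(a, l). (1 + l * u) powr (- a))"
      by simp
    also have "\<dots> = phi u"
      unfolding AL phi_def using m by (subst integral_distr) (auto simp: case_prod_beta)
    finally show ?thesis .
  qed
  show ?thesis
    unfolding satisfies_equation_def equation_rhs_def sT
    using sB[OF sig_bounds(1)[OF F mean]] ph[OF sigB_bounds(1)[OF sig_bounds(1)[OF F mean]]] by auto
qed

text \<open>The maps \<open>\<sigma>\<close> and \<open>\<sigma>\<^sub>B\<close> are expectations of \<open>exp_primitive\<close>, so \<open>e\<^sup>-\<^sup>c\<^sup>\<sigma>\<close> and \<open>e\<^sup>-\<^sup>c\<^sup>\<sigma>\<^sup>B\<close> are transforms, and \<open>\<phi>\<close> is a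
  mixture of gamma transforms; subordination composes the three.\<close>

lemma is_LST_equation_rhs:
  assumes F: "nonneg_distribution F" and mean: "has_mean F \<mu>"
  shows "is_LST (equation_rhs F)"
proof -
  note F' = nonneg_distributionD[OF F]
  note [measurable_cong] = F'(3)
  interpret F: prob_space F by (rule F')
  interpret P: pair_prob_space M F ..
  have sig: "is_LST (\<lambda>s. exp (- (c * sig F s)))" if c: "0 \<le> c" for c
  proof -
    have iF: "integrable F (\<lambda>x. x)" using mean by (simp add: has_mean_def)
    have iP: "integrable (M \<Otimes>\<^sub>M F) (\<lambda>z. snd z)"
      by (rule P.Fubini_integrable) (use iF in auto)
    have AE: "AE z in M \<Otimes>\<^sub>M F. 0 \<le> T (fst z) \<and> 0 \<le> snd z"
    proof (rule P.AE_pair_measure)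
      show "AE x in M. AE y in F. 0 \<le> T (fst (x, y)) \<and> 0 \<le> snd (x, y)"
        using T_nonneg by eventually_elim (use F'(5) in \<open>auto elim!: eventually_mono\<close>)
    qed auto
    have AE': "AE z in M \<Otimes>\<^sub>M F. 0 \<le> snd z" "AE z in M \<Otimes>\<^sub>M F. 0 \<le> T (fst z) * snd z"
      using AE by (auto elim!: eventually_mono simp del: AE_conj_iff)
    have mix: "is_LST (\<lambda>s. exp (- (LINT z|(M \<Otimes>\<^sub>M F). c * snd z * exp_primitive (T (fst z) * snd z) s)))"
      by (rule is_LST_exp_minus_integral[OF P.prob_space_axioms]) (use iP AE' c in \<open>auto elim!: eventually_mono\<close>)
    have eq: "(LINT z|(M \<Otimes>\<^sub>M F). c * snd z * exp_primitive (T (fst z) * snd z) s) = c * sig F s" if s: "0 \<le> s" for s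
    proof -
      have "integrable (M \<Otimes>\<^sub>M F) (\<lambda>z. snd z * exp_primitive (T (fst z) * snd z) s)"
      proof (rule Bochner_Integration.integrable_bound[OF integrable_mult_right[OF iP, of s]])
        show "AE z in M \<Otimes>\<^sub>M F. norm (snd z * exp_primitive (T (fst z) * snd z) s) \<le> norm (s * snd z)"
          using AE
        proof eventually_elim
          case (elim z)
          thus ?case using exp_primitive_nonneg[of "T (fst z) * snd z" s] exp_primitive_le[of "T (fst z) * snd z" s] s
            by (auto simp: abs_mult mult.commute[of s] intro!: mult_left_mono)
        qed
      qed measurable
      from P.integral_fst'[OF this]
      have "(LINT z|(M \<Otimes>\<^sub>M F). snd z * exp_primitive (T (fst z) * snd z) s) = expectation (\<lambda>\<omega>. LINT x|F. x * exp_primitive (T \<omega> * x) s)"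
        by simp
      also have "\<dots> = sig F s" unfolding sig_def
      proof (rule integral_cong_AE)
        show "AE \<omega> in M. (LINT x|F. x * exp_primitive (T \<omega> * x) s) = sigma_integrand F (T \<omega>) s"
          using T_nonneg by eventually_elim (rule sigma_integrand_eq_integral[OF F mean _ s, symmetric])
      qed (use measurable_sigma_integrand[OF F] in measurable)
      finally show ?thesis by (simp add: mult.assoc)
    qed
    show ?thesis by (rule is_LST_transfer[OF mix]) (simp add: eq)
  qed
  have sigB: "is_LST (\<lambda>s. exp (- (c * sigB s)))" if c: "0 \<le> c" for c
    using is_LST_exp_minus_integral[OF prob_space_axioms, of "\<lambda>_. c" B] c B_nonneg
    by (simp add: sigB_def)
  have phi: "is_LST phi"
  proof -
    \<comment> \<open>the maximum keeps the base positive for all arguments, which gives continuity everywhere\<close>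
    let ?H = "\<lambda>v s. (1 + max 0 (\<bar>snd v\<bar> * s)) powr (- \<bar>fst v\<bar>)"
    have "is_LST (\<lambda>s. (1 + l * s) powr (- a))" if "0 \<le> l" "0 \<le> a" for l a :: real
      by (rule is_LST_compose[OF is_LST_one_plus_powr[OF that(2)], of "\<lambda>s. l * s"])
        (use that is_LST_exp in \<open>auto simp: mult.assoc[symmetric]\<close>)
    hence H: "is_LST (?H v)" for v
      by (rule is_LST_transfer[of "\<lambda>s. (1 + \<bar>snd v\<bar> * s) powr (- \<bar>fst v\<bar>)"]) (auto simp: max_def)
    have pos: "1 + \<bar>x\<bar> * s \<noteq> 0" if "0 \<le> s" for x s :: real
      using mult_nonneg_nonneg[of "\<bar>x\<bar>" s] that by linarith
    have mix: "is_LST (\<lambda>s. expectation (\<lambda>\<omega>. ?H (A \<omega>, L \<omega>) s))"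
      by (rule is_LST_mixture[OF prob_space_axioms _ H]) (auto intro!: continuous_intros simp: pos)
    have eq: "expectation (\<lambda>\<omega>. ?H (A \<omega>, L \<omega>) s) = phi s" if "0 \<le> s" for s
      unfolding phi_def
    proof (rule integral_cong_AE)
      show "AE \<omega> in M. ?H (A \<omega>, L \<omega>) s = (1 + L \<omega> * s) powr (- A \<omega>)"
        using A_nonneg L_nonneg by eventually_elim (use that in \<open>auto simp: max_def\<close>)
    qed measurable
    show ?thesis by (rule is_LST_transfer[OF mix eq])
  qed
  show ?thesis unfolding equation_rhs_def[abs_def]
    by (rule is_LST_compose[OF is_LST_compose[OF phi sigB] sig])
qed

lemma phi_remainder:
  assumes u: "0 \<le> u" and AL: "integrable M (\<lambda>\<omega>. A \<omega> * L \<omega>)" "expectation (\<lambda>\<omega>. A \<omega> * L \<omega>) = 1"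
  shows "phi u - 1 + u = expectation (\<lambda>\<omega>. (1 + L \<omega> * u) powr (- A \<omega>) - 1 + A \<omega> * L \<omega> * u)"
    "0 \<le> phi u - 1 + u"
proof -
  show eq: "phi u - 1 + u = expectation (\<lambda>\<omega>. (1 + L \<omega> * u) powr (- A \<omega>) - 1 + A \<omega> * L \<omega> * u)"
    using phi_integrable[OF u] AL by (simp add: phi_def prob_space)
  show "0 \<le> phi u - 1 + u" unfolding eq
  proof (rule integral_nonneg_AE)
    show "AE \<omega> in M. 0 \<le> (1 + L \<omega> * u) powr (- A \<omega>) - 1 + A \<omega> * L \<omega> * u"
      using A_nonneg L_nonneg
    proof eventually_elim
      case (elim \<omega>)
      thus ?case using one_plus_powr_ge[of "L \<omega> * u" "A \<omega>"] u by simp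
    qed
  qed
qed

section \<open>Expansion of the equation at a solution\<close>

lemma sigB_ratio_limit:
  fixes u :: "nat \<Rightarrow> real"
  assumes u: "u \<longlonglongrightarrow> 0" "\<And>n. 0 < u n"
  shows "(\<lambda>n. sigB (u n) / u n) \<longlonglongrightarrow> 1"
proof -
  have "(\<lambda>n. expectation (\<lambda>\<omega>. exp_primitive (B \<omega>) (u n) / u n)) \<longlonglongrightarrow> expectation (\<lambda>\<omega>. 1)"
  proof (rule integral_dominated_convergence[where w="\<lambda>_. 1"])
    show "AE \<omega> in M. (\<lambda>n. exp_primitive (B \<omega>) (u n) / u n) \<longlonglongrightarrow> 1"
      using B_nonneg
    proof eventually_elim
      case (elim \<omega>)
      show ?case
      proof (rule tendsto_sandwich)
        have "(\<lambda>n. 1 - B \<omega> * u n / 2) \<longlonglongrightarrow> 1 - B \<omega> * 0 / 2" by (intro tendsto_intros u) auto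
        thus "(\<lambda>n. 1 - B \<omega> * u n / 2) \<longlonglongrightarrow> 1" by simp
        show "\<forall>\<^sub>F n in sequentially. 1 - B \<omega> * u n / 2 \<le> exp_primitive (B \<omega>) (u n) / u n"
        proof (intro always_eventually allI)
          fix n
          have "(1 - B \<omega> * u n / 2) * u n \<le> exp_primitive (B \<omega>) (u n)"
            using exp_primitive_ge[OF elim, of "u n"] u(2)[of n] by (simp add: algebra_simps power2_eq_square)
          thus "1 - B \<omega> * u n / 2 \<le> exp_primitive (B \<omega>) (u n) / u n" using u(2)[of n] by (simp add: le_divide_eq)
        qed
        show "\<forall>\<^sub>F n in sequentially. exp_primitive (B \<omega>) (u n) / u n \<le> 1"
          using exp_primitive_le[OF elim] u(2) by (intro always_eventually) (simp add: divide_le_eq)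
      qed simp
    qed
    show "AE \<omega> in M. norm (exp_primitive (B \<omega>) (u n) / u n) \<le> 1" for n
      using B_nonneg
    proof eventually_elim
      case (elim \<omega>)
      show ?case using exp_primitive_le[OF elim, of "u n"] exp_primitive_nonneg[OF elim, of "u n"] u(2)[of n] by (simp add: divide_le_eq)
    qed
  qed auto
  thus ?thesis by (simp add: sigB_def prob_space)
qed

lemma sig_ratio_limit:
  assumes F: "nonneg_distribution F" and mean: "has_mean F \<mu>" and sq: "integrable F (\<lambda>x. x\<^sup>2)"
    and u: "u \<longlonglongrightarrow> 0" "\<And>n. 0 < u n"
  shows "(\<lambda>n. sig F (u n) / u n) \<longlonglongrightarrow> \<mu>"
proof -
  note [measurable] = measurable_sigma_integrand[OF F]
  have "(\<lambda>n. expectation (\<lambda>\<omega>. sigma_integrand F (T \<omega>) (u n) / u n)) \<longlonglongrightarrow> expectation (\<lambda>\<omega>. \<mu>)"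
  proof (rule integral_dominated_convergence[where w="\<lambda>_. \<mu>"])
    show "AE \<omega> in M. (\<lambda>n. sigma_integrand F (T \<omega>) (u n) / u n) \<longlonglongrightarrow> \<mu>"
      using T_nonneg
    proof eventually_elim
      case (elim \<omega>)
      have "(\<lambda>n. \<mu> - (\<mu> * u n - sigma_integrand F (T \<omega>) (u n)) / (u n)\<^sup>2 * u n) \<longlonglongrightarrow> \<mu> - T \<omega> * (LINT x|F. x\<^sup>2) / 2 * 0"
        by (intro tendsto_intros sigma_integrand_remainder_limit[OF F mean sq elim u] u)
      moreover have "\<mu> - (\<mu> * u n - sigma_integrand F (T \<omega>) (u n)) / (u n)\<^sup>2 * u n = sigma_integrand F (T \<omega>) (u n) / u n" for n
        using u(2)[of n] by (simp add: field_simps power2_eq_square)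
      ultimately show ?case by simp
    qed
    show "AE \<omega> in M. norm (sigma_integrand F (T \<omega>) (u n) / u n) \<le> \<mu>" for n
      using T_nonneg
    proof eventually_elim
      case (elim \<omega>)
      show ?case using sigma_integrand_bounds[OF F mean elim, of "u n"] u(2)[of n] by (simp add: divide_le_eq)
    qed
  qed auto
  thus ?thesis by (simp add: sig_def prob_space)
qed

text \<open>The second-order expansion of the equation at \<open>0\<close>, by the splitting of the remainder described at the top:
  the moments of \<open>A\<close>, \<open>L\<close>, \<open>B\<close> and \<open>T\<close> all come out of the finite second moment of the solution.\<close>

lemma expansion_at_solution:
  assumes mu: "0 < \<mu>" and F: "nonneg_distribution F" and mean: "has_mean F \<mu>"
    and sq: "integrable F (\<lambda>x. x\<^sup>2)" and sol: "\<And>s. 0 \<le> s \<Longrightarrow> LST F s = equation_rhs F s"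
  shows "integrable M (\<lambda>\<omega>. A \<omega> * L \<omega>) \<and> expectation (\<lambda>\<omega>. A \<omega> * L \<omega>) = 1 \<and>
    integrable M (\<lambda>\<omega>. A \<omega> * (A \<omega> + 1) * (L \<omega>)\<^sup>2) \<and> integrable M B \<and> integrable M T \<and>
    (LINT x|F. x\<^sup>2) = (expectation (\<lambda>\<omega>. A \<omega> * (A \<omega> + 1) * (L \<omega>)\<^sup>2) + expectation B) * \<mu>\<^sup>2
      + expectation T * (LINT x|F. x\<^sup>2)"
proof -
  define m where "m = (LINT x|F. x\<^sup>2)"
  have mb: "moments_below \<mu> m F" using F mean sq by (simp add: moments_below_def m_def)
  note [measurable] = measurable_sigma_integrand[OF F]
  interpret F: prob_space F by (rule nonneg_distributionD[OF F])
  have m_pos: "0 < m"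
  proof -
    have iF: "integrable F (\<lambda>x. x)" "F.expectation (\<lambda>x. x) = \<mu>" using mean by (auto simp: has_mean_def mean_def)
    have "0 \<le> F.variance (\<lambda>x. x)" by (rule F.variance_positive)
    also have "F.variance (\<lambda>x. x) = m - \<mu>\<^sup>2" using F.variance_eq[OF iF(1) sq] iF(2) by (simp add: m_def)
    finally show ?thesis using mu zero_less_power[of \<mu> 2] by linarith
  qed
  \<comment> \<open>A null sequence along which \<open>\<sigma>\<close> and \<open>\<sigma>\<^sub>B \<circ> \<sigma>\<close> are positive, so that they can be divided by; the
    limits of their ratios show that a tail of \<open>1/n\<close> will do.\<close>
  define z where "z n = 1 / real (Suc n)" for n
  have z: "z \<longlonglongrightarrow> 0" "0 < z n" for n
    unfolding z_def using LIMSEQ_inverse_real_of_nat by (auto simp: inverse_eq_divide)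
  have "\<forall>\<^sub>F n in sequentially. 0 < sig F (z n) / z n"
    using order_tendstoD(1)[OF sig_ratio_limit[OF F mean sq z] mu] .
  then obtain N where N: "\<And>n. N \<le> n \<Longrightarrow> 0 < sig F (z n) / z n" by (auto simp: eventually_sequentially)
  have "0 < sig F (z (n + N))" for n using N[of "n + N"] z(2)[of "n + N"] by (simp add: zero_less_divide_iff)
  moreover have "(\<lambda>n. sig F (z (n + N))) \<longlonglongrightarrow> 0"
  proof -
    have "(\<lambda>n. sig F (z n) / z n * z n) \<longlonglongrightarrow> \<mu> * 0" by (intro tendsto_intros sig_ratio_limit[OF F mean sq z] z)
    moreover have "sig F (z n) / z n * z n = sig F (z n)" for n using z(2)[of n] by simp
    ultimately have "(\<lambda>n. sig F (z n)) \<longlonglongrightarrow> 0" by simp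
    thus ?thesis by (rule LIMSEQ_ignore_initial_segment)
  qed
  ultimately have "\<forall>\<^sub>F n in sequentially. 0 < sigB (sig F (z (n + N))) / sig F (z (n + N))"
    by (intro order_tendstoD(1)[OF sigB_ratio_limit]) auto
  then obtain N' where N': "\<And>n. N' \<le> n \<Longrightarrow> 0 < sigB (sig F (z (n + N))) / sig F (z (n + N))"
    by (auto simp: eventually_sequentially)
  define s where "s n = z (n + N' + N)" for n
  have s: "s \<longlonglongrightarrow> 0" "0 < s n" for n
    using LIMSEQ_ignore_initial_segment[OF z(1), of "N' + N"] z(2) by (auto simp: s_def[abs_def] add.assoc)
  define y where "y n = sig F (s n)" for n
  define u where "u n = sigB (y n)" for n
  have y_pos: "0 < y n" for n
    unfolding y_def s_def using N[of "n + N' + N"] z(2)[of "n + N' + N"] by (simp add: zero_less_divide_iff)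
  have u_pos: "0 < u n" for n
    using N'[of "n + N'"] y_pos[of n] by (simp add: zero_less_divide_iff u_def y_def s_def)
  have u_le: "u n \<le> y n" and y_le: "y n \<le> \<mu> * s n" for n
    using sigB_bounds(2)[of "y n"] y_pos[of n] sig_bounds(2)[OF F mean, of "s n"] s(2)[of n]
    by (auto simp: u_def y_def)
  have ys: "(\<lambda>n. y n / s n) \<longlonglongrightarrow> \<mu>" unfolding y_def by (rule sig_ratio_limit[OF F mean sq s])
  have y0: "y \<longlonglongrightarrow> 0"
  proof -
    have "(\<lambda>n. y n / s n * s n) \<longlonglongrightarrow> \<mu> * 0" by (intro tendsto_intros ys s)
    moreover have "y n / s n * s n = y n" for n using s(2)[of n] by simp
    ultimately show ?thesis by simp
  qed
  have uy: "(\<lambda>n. u n / y n) \<longlonglongrightarrow> 1" unfolding u_def by (rule sigB_ratio_limit[OF y0 y_pos])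
  have u0: "u \<longlonglongrightarrow> 0"
  proof -
    have "(\<lambda>n. u n / y n * y n) \<longlonglongrightarrow> 1 * 0" by (intro tendsto_intros uy y0)
    moreover have "u n / y n * y n = u n" for n using y_pos[of n] by simp
    ultimately show ?thesis by simp
  qed
  have us: "(\<lambda>n. u n / s n) \<longlonglongrightarrow> \<mu>"
  proof -
    have "(\<lambda>n. u n / y n * (y n / s n)) \<longlonglongrightarrow> 1 * \<mu>" by (intro tendsto_intros uy ys)
    moreover have "u n / y n * (y n / s n) = u n / s n" for n using y_pos[of n] by simp
    ultimately show ?thesis by (simp only: mult_1)
  qed
  have f: "LST F (s n) = phi (u n)" for n
    using sol[of "s n"] s(2)[of n] by (simp add: equation_rhs_def u_def y_def)
  define R where "R n = (LST F (s n) - 1 + \<mu> * s n) / (s n)\<^sup>2" for n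
  have R_le: "R n \<le> m / 2" for n
    unfolding R_def using LST_upper[OF mb, of "s n"] s(2)[of n] by (simp add: divide_le_eq)
  have R: "R \<longlonglongrightarrow> m / 2"
    unfolding R_def m_def
    by (rule LST_remainder_limit(2)[OF F mean s, where K="m / 2"]) (use R_le in \<open>simp add: R_def\<close>)

  \<comment> \<open>The first-order expansions of both sides of the equation yield \<open>E[AL] = 1\<close>.\<close>
  have ratio: "(\<lambda>n. (1 - phi (u n)) / u n) \<longlonglongrightarrow> 1"
  proof -
    have "(\<lambda>n. (\<mu> - R n * s n) / (u n / s n)) \<longlonglongrightarrow> (\<mu> - m / 2 * 0) / \<mu>"
      using mu by (intro tendsto_intros R s us) auto
    moreover have "(\<mu> - R n * s n) / (u n / s n) = (1 - phi (u n)) / u n" for n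
      unfolding R_def f[symmetric] using s(2)[of n] u_pos[of n] by (simp add: field_simps power2_eq_square)
    ultimately have "(\<lambda>n. (1 - phi (u n)) / u n) \<longlonglongrightarrow> (\<mu> - m / 2 * 0) / \<mu>" by (simp only:)
    thus ?thesis using mu by simp
  qed
  obtain K1 where K1: "\<And>n. (1 - phi (u n)) / u n \<le> K1"
    using convergent_bounded_above[OF ratio] by blast
  have phi1: "(1 - phi (u n)) / u n = expectation (\<lambda>\<omega>. (1 - (1 + L \<omega> * u n) powr (- A \<omega>)) / u n)" for n
    using phi_integrable[of "u n"] u_pos[of n] by (simp add: phi_def prob_space)
  have first: "integrable M (\<lambda>\<omega>. A \<omega> * L \<omega>) \<and>
      (\<lambda>n. expectation (\<lambda>\<omega>. (1 - (1 + L \<omega> * u n) powr (- A \<omega>)) / u n)) \<longlonglongrightarrow> expectation (\<lambda>\<omega>. A \<omega> * L \<omega>)"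
  proof (rule convergence_below_limit[where K=K1])
    show "integrable M (\<lambda>\<omega>. (1 - (1 + L \<omega> * u n) powr (- A \<omega>)) / u n)" for n
      using phi_integrable[of "u n"] u_pos[of n] by auto
    show "AE \<omega> in M. 0 \<le> (1 - (1 + L \<omega> * u n) powr (- A \<omega>)) / u n \<and>
        (1 - (1 + L \<omega> * u n) powr (- A \<omega>)) / u n \<le> A \<omega> * L \<omega>" for n
      using A_nonneg L_nonneg
    proof eventually_elim
      case (elim \<omega>)
      thus ?case using one_plus_powr_diff[of "L \<omega>" "A \<omega>" 0 "u n"] u_pos[of n] by (simp add: divide_le_eq)
    qed
    show "AE \<omega> in M. (\<lambda>n. (1 - (1 + L \<omega> * u n) powr (- A \<omega>)) / u n) \<longlonglongrightarrow> A \<omega> * L \<omega>"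
      using L_nonneg
    proof eventually_elim
      case (elim \<omega>)
      have "(\<lambda>n. A \<omega> * L \<omega> - ((1 + L \<omega> * u n) powr (- A \<omega>) - 1 + A \<omega> * L \<omega> * u n) / (u n)\<^sup>2 * u n)
          \<longlonglongrightarrow> A \<omega> * L \<omega> - A \<omega> * (A \<omega> + 1) * (L \<omega>)\<^sup>2 / 2 * 0"
        by (intro tendsto_intros one_plus_powr_remainder_limit elim u0 u_pos)
      moreover have "A \<omega> * L \<omega> - ((1 + L \<omega> * u n) powr (- A \<omega>) - 1 + A \<omega> * L \<omega> * u n) / (u n)\<^sup>2 * u n
          = (1 - (1 + L \<omega> * u n) powr (- A \<omega>)) / u n" for n
        using u_pos[of n] by (simp add: field_simps power2_eq_square)
      ultimately show ?case by simp
    qed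
    show "expectation (\<lambda>\<omega>. (1 - (1 + L \<omega> * u n) powr (- A \<omega>)) / u n) \<le> K1" for n
      using K1[of n] phi1 by simp
  qed measurable
  hence AL: "integrable M (\<lambda>\<omega>. A \<omega> * L \<omega>)" by blast
  have AL1: "expectation (\<lambda>\<omega>. A \<omega> * L \<omega>) = 1"
    using LIMSEQ_unique[OF ratio[unfolded phi1] conjunct2[OF first]] by simp

  \<comment> \<open>The three normalized remainders. As they are nonnegative, each is bounded, up to a
    convergent factor, by the remainder \<open>R\<close> of the solution, which converges.\<close>
  define P where "P n = (phi (u n) - 1 + u n) / (u n)\<^sup>2" for n
  define Q where "Q n = (y n - u n) / (y n)\<^sup>2" for n
  define V where "V n = (\<mu> * s n - y n) / (s n)\<^sup>2" for n
  have decomp: "R n = P n * (u n / s n)\<^sup>2 + Q n * (y n / s n)\<^sup>2 + V n" for n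
    using u_pos[of n] y_pos[of n] s(2)[of n]
    by (simp add: R_def P_def Q_def V_def f power_divide add_divide_distrib[symmetric])
  have P_nonneg: "0 \<le> P n" for n
    using phi_remainder(2)[OF _ AL AL1, of "u n"] u_pos[of n] by (simp add: P_def)
  have Q_nonneg: "0 \<le> Q n" and V_nonneg: "0 \<le> V n" for n
    using u_le[of n] y_le[of n] by (simp_all add: Q_def V_def)
  have us2: "(\<lambda>n. (u n / s n)\<^sup>2) \<longlonglongrightarrow> \<mu>\<^sup>2" and ys2: "(\<lambda>n. (y n / s n)\<^sup>2) \<longlonglongrightarrow> \<mu>\<^sup>2"
    by (intro tendsto_power us ys)+
  have bounded: "\<exists>K. \<forall>n. X n \<le> K"
    if X: "\<And>n. X n * (w n)\<^sup>2 \<le> R n" and w: "(\<lambda>n. (w n)\<^sup>2) \<longlonglongrightarrow> \<mu>\<^sup>2" "\<And>n. 0 < w n" for X w :: "nat \<Rightarrow> real"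
  proof -
    have "(\<lambda>n. R n / (w n)\<^sup>2) \<longlonglongrightarrow> m / 2 / \<mu>\<^sup>2" using mu by (intro tendsto_intros R w) auto
    then obtain K where "\<And>n. R n / (w n)\<^sup>2 \<le> K" using convergent_bounded_above by blast
    moreover have "X n \<le> R n / (w n)\<^sup>2" for n using X[of n] w(2)[of n] by (simp add: le_divide_eq)
    ultimately show ?thesis by (meson order_trans)
  qed
  have sq_nonneg: "0 \<le> P n * (u n / s n)\<^sup>2" "0 \<le> Q n * (y n / s n)\<^sup>2" for n
    using P_nonneg Q_nonneg by simp_all
  have "\<exists>K. \<forall>n. P n \<le> K"
    by (rule bounded[OF _ us2]) (use decomp sq_nonneg V_nonneg u_pos s(2) in \<open>auto intro: add_increasing2\<close>)
  then obtain KP where KP: "\<And>n. P n \<le> KP" by blast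
  have "\<exists>K. \<forall>n. Q n \<le> K"
    by (rule bounded[OF _ ys2]) (use decomp sq_nonneg V_nonneg y_pos s(2) in \<open>auto intro: add_increasing add_increasing2\<close>)
  then obtain KQ where KQ: "\<And>n. Q n \<le> KQ" by blast
  have V_le: "V n \<le> m / 2" for n using decomp[of n] sq_nonneg[of n] R_le[of n] by linarith

  have P_int: "P n = expectation (\<lambda>\<omega>. ((1 + L \<omega> * u n) powr (- A \<omega>) - 1 + A \<omega> * L \<omega> * u n) / (u n)\<^sup>2)" for n
    unfolding P_def using phi_remainder(1)[OF _ AL AL1, of "u n"] u_pos[of n] by simp
  have second: "integrable M (\<lambda>\<omega>. A \<omega> * (A \<omega> + 1) * (L \<omega>)\<^sup>2 / 2) \<and>
      (\<lambda>n. expectation (\<lambda>\<omega>. ((1 + L \<omega> * u n) powr (- A \<omega>) - 1 + A \<omega> * L \<omega> * u n) / (u n)\<^sup>2))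
        \<longlonglongrightarrow> expectation (\<lambda>\<omega>. A \<omega> * (A \<omega> + 1) * (L \<omega>)\<^sup>2 / 2)"
  proof (rule convergence_below_limit[where K=KP])
    show "integrable M (\<lambda>\<omega>. ((1 + L \<omega> * u n) powr (- A \<omega>) - 1 + A \<omega> * L \<omega> * u n) / (u n)\<^sup>2)" for n
      using phi_integrable[of "u n"] u_pos[of n] AL by auto
    show "AE \<omega> in M. 0 \<le> ((1 + L \<omega> * u n) powr (- A \<omega>) - 1 + A \<omega> * L \<omega> * u n) / (u n)\<^sup>2 \<and>
        ((1 + L \<omega> * u n) powr (- A \<omega>) - 1 + A \<omega> * L \<omega> * u n) / (u n)\<^sup>2 \<le> A \<omega> * (A \<omega> + 1) * (L \<omega>)\<^sup>2 / 2" for n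
      using A_nonneg L_nonneg
    proof eventually_elim
      case (elim \<omega>)
      thus ?case using one_plus_powr_ge[of "L \<omega> * u n" "A \<omega>"] one_plus_powr_le[of "L \<omega> * u n" "A \<omega>"] u_pos[of n]
        by (simp add: divide_le_eq power_mult_distrib mult.assoc)
    qed
    show "AE \<omega> in M. (\<lambda>n. ((1 + L \<omega> * u n) powr (- A \<omega>) - 1 + A \<omega> * L \<omega> * u n) / (u n)\<^sup>2)
        \<longlonglongrightarrow> A \<omega> * (A \<omega> + 1) * (L \<omega>)\<^sup>2 / 2"
      using L_nonneg by eventually_elim (rule one_plus_powr_remainder_limit[OF _ u0 u_pos])
    show "expectation (\<lambda>\<omega>. ((1 + L \<omega> * u n) powr (- A \<omega>) - 1 + A \<omega> * L \<omega> * u n) / (u n)\<^sup>2) \<le> KP" for n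
      using KP[of n] P_int by simp
  qed measurable
  hence P_lim: "P \<longlonglongrightarrow> expectation (\<lambda>\<omega>. A \<omega> * (A \<omega> + 1) * (L \<omega>)\<^sup>2) / 2"
    unfolding P_int by simp
  have D_int: "integrable M (\<lambda>\<omega>. A \<omega> * (A \<omega> + 1) * (L \<omega>)\<^sup>2)"
    using integrable_mult_right[OF conjunct1[OF second], of 2] by simp

  have Q_int: "Q n = expectation (\<lambda>\<omega>. (y n - exp_primitive (B \<omega>) (y n)) / (y n)\<^sup>2)" for n
    unfolding Q_def u_def sigB_def using sigB_integrable[of "y n"] y_pos[of n] by (simp add: prob_space)
  have third: "integrable M (\<lambda>\<omega>. B \<omega> / 2) \<and>
      (\<lambda>n. expectation (\<lambda>\<omega>. (y n - exp_primitive (B \<omega>) (y n)) / (y n)\<^sup>2)) \<longlonglongrightarrow> expectation (\<lambda>\<omega>. B \<omega> / 2)"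
  proof (rule convergence_below_limit[where K=KQ])
    show "integrable M (\<lambda>\<omega>. (y n - exp_primitive (B \<omega>) (y n)) / (y n)\<^sup>2)" for n
      using sigB_integrable[of "y n"] y_pos[of n] by auto
    show "AE \<omega> in M. 0 \<le> (y n - exp_primitive (B \<omega>) (y n)) / (y n)\<^sup>2 \<and> (y n - exp_primitive (B \<omega>) (y n)) / (y n)\<^sup>2 \<le> B \<omega> / 2" for n
      using B_nonneg
    proof eventually_elim
      case (elim \<omega>)
      thus ?case using exp_primitive_le[OF elim, of "y n"] exp_primitive_ge[OF elim, of "y n"] y_pos[of n]
        by (simp add: divide_le_eq)
    qed
    show "AE \<omega> in M. (\<lambda>n. (y n - exp_primitive (B \<omega>) (y n)) / (y n)\<^sup>2) \<longlonglongrightarrow> B \<omega> / 2"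
      using B_nonneg by eventually_elim (rule exp_primitive_remainder_limit[OF _ y0 y_pos])
    show "expectation (\<lambda>\<omega>. (y n - exp_primitive (B \<omega>) (y n)) / (y n)\<^sup>2) \<le> KQ" for n using KQ[of n] Q_int by simp
  qed measurable
  hence Q_lim: "Q \<longlonglongrightarrow> expectation B / 2" unfolding Q_int by simp
  have B_int: "integrable M B"
    using integrable_mult_right[OF conjunct1[OF third], of 2] by simp

  have V_int: "V n = expectation (\<lambda>\<omega>. (\<mu> * s n - sigma_integrand F (T \<omega>) (s n)) / (s n)\<^sup>2)" for n
    unfolding V_def y_def sig_def using sig_integrable[OF F mean, of "s n"] s(2)[of n] by (simp add: prob_space)
  have fourth: "integrable M (\<lambda>\<omega>. T \<omega> * m / 2) \<and>
      (\<lambda>n. expectation (\<lambda>\<omega>. (\<mu> * s n - sigma_integrand F (T \<omega>) (s n)) / (s n)\<^sup>2)) \<longlonglongrightarrow> expectation (\<lambda>\<omega>. T \<omega> * m / 2)"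
  proof (rule convergence_below_limit[where K="m / 2"])
    show "integrable M (\<lambda>\<omega>. (\<mu> * s n - sigma_integrand F (T \<omega>) (s n)) / (s n)\<^sup>2)" for n
      using sig_integrable[OF F mean, of "s n"] s(2)[of n] by auto
    show "AE \<omega> in M. 0 \<le> (\<mu> * s n - sigma_integrand F (T \<omega>) (s n)) / (s n)\<^sup>2 \<and>
        (\<mu> * s n - sigma_integrand F (T \<omega>) (s n)) / (s n)\<^sup>2 \<le> T \<omega> * m / 2" for n
      using T_nonneg
    proof eventually_elim
      case (elim \<omega>)
      thus ?case using sigma_integrand_bounds(2)[OF F mean elim, of "s n"] sigma_integrand_lower[OF mb elim, of "s n"] s(2)[of n]
        by (simp add: divide_le_eq)
    qed
    show "AE \<omega> in M. (\<lambda>n. (\<mu> * s n - sigma_integrand F (T \<omega>) (s n)) / (s n)\<^sup>2) \<longlonglongrightarrow> T \<omega> * m / 2"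
      unfolding m_def using T_nonneg by eventually_elim (rule sigma_integrand_remainder_limit[OF F mean sq _ s])
    show "expectation (\<lambda>\<omega>. (\<mu> * s n - sigma_integrand F (T \<omega>) (s n)) / (s n)\<^sup>2) \<le> m / 2" for n using V_le[of n] V_int by simp
  qed measurable
  hence V_lim: "V \<longlonglongrightarrow> expectation T * m / 2" unfolding V_int by simp
  have T_int: "integrable M T"
    using integrable_mult_right[OF conjunct1[OF fourth], of "2 / m"] m_pos by simp

  have "(\<lambda>n. P n * (u n / s n)\<^sup>2 + Q n * (y n / s n)\<^sup>2 + V n) \<longlonglongrightarrow>
      expectation (\<lambda>\<omega>. A \<omega> * (A \<omega> + 1) * (L \<omega>)\<^sup>2) / 2 * \<mu>\<^sup>2 + expectation B / 2 * \<mu>\<^sup>2 + expectation T * m / 2"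
    by (intro tendsto_intros P_lim Q_lim V_lim us2 ys2)
  from LIMSEQ_unique[OF this[folded decomp] R]
  have "m = (expectation (\<lambda>\<omega>. A \<omega> * (A \<omega> + 1) * (L \<omega>)\<^sup>2) + expectation B) * \<mu>\<^sup>2 + expectation T * m"
    by (simp add: field_simps)
  thus ?thesis using AL AL1 D_int B_int T_int by (simp add: m_def)
qed

section \<open>Existence and uniqueness by contraction\<close>

lemma phi_diff:
  assumes AL: "integrable M (\<lambda>\<omega>. A \<omega> * L \<omega>)" "expectation (\<lambda>\<omega>. A \<omega> * L \<omega>) = 1"
    and "0 \<le> u" "u \<le> v"
  shows "0 \<le> phi u - phi v" "phi u - phi v \<le> v - u"
proof -
  have i: "integrable M (\<lambda>\<omega>. (1 + L \<omega> * u) powr (- A \<omega>))" "integrable M (\<lambda>\<omega>. (1 + L \<omega> * v) powr (- A \<omega>))"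
    using phi_integrable assms by auto
  have eq: "phi u - phi v = expectation (\<lambda>\<omega>. (1 + L \<omega> * u) powr (- A \<omega>) - (1 + L \<omega> * v) powr (- A \<omega>))"
    using i by (simp add: phi_def)
  have ae: "AE \<omega> in M. 0 \<le> (1 + L \<omega> * u) powr (- A \<omega>) - (1 + L \<omega> * v) powr (- A \<omega>) \<and>
      (1 + L \<omega> * u) powr (- A \<omega>) - (1 + L \<omega> * v) powr (- A \<omega>) \<le> A \<omega> * L \<omega> * (v - u)"
    using A_nonneg L_nonneg
  proof eventually_elim
    case (elim \<omega>)
    thus ?case using one_plus_powr_diff[of "L \<omega>" "A \<omega>" u v] assms by simp
  qed
  show "0 \<le> phi u - phi v" unfolding eq by (rule integral_nonneg_AE) (use ae in auto)
  have "phi u - phi v \<le> expectation (\<lambda>\<omega>. A \<omega> * L \<omega> * (v - u))" unfolding eq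
    by (rule integral_mono_AE) (use ae i AL in auto)
  thus "phi u - phi v \<le> v - u" using AL by simp
qed

text \<open>For \<open>t > 0\<close> the integrands of \<open>\<sigma>\<close> differ by at most \<open>K (ts)\<^sup>2/t = t K s\<^sup>2\<close>, and at \<open>t = 0\<close> they agree
  because the means do. The quadratic weight is what makes \<open>E[T]\<close> the contraction factor.\<close>

lemma equation_rhs_contracts:
  assumes T_int: "integrable M T"
    and AL: "integrable M (\<lambda>\<omega>. A \<omega> * L \<omega>)" "expectation (\<lambda>\<omega>. A \<omega> * L \<omega>) = 1"
    and F: "nonneg_distribution F" "has_mean F \<mu>" and G: "nonneg_distribution G" "has_mean G \<mu>"
    and K: "\<And>s. 0 \<le> s \<Longrightarrow> \<bar>LST F s - LST G s\<bar> \<le> K * s\<^sup>2" and s: "0 \<le> s"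
  shows "\<bar>equation_rhs F s - equation_rhs G s\<bar> \<le> expectation T * K * s\<^sup>2"
proof -
  have i: "integrable M (\<lambda>\<omega>. sigma_integrand F (T \<omega>) s)" "integrable M (\<lambda>\<omega>. sigma_integrand G (T \<omega>) s)"
    using sig_integrable[OF F s] sig_integrable[OF G s] by auto
  have "\<bar>sigma_integrand F t s - sigma_integrand G t s\<bar> \<le> t * (K * s\<^sup>2)" if t: "0 \<le> t" for t
  proof (cases "t = 0")
    case True
    thus ?thesis using F G by (simp add: sigma_integrand_def has_mean_def)
  next
    case False
    have "\<bar>sigma_integrand F t s - sigma_integrand G t s\<bar> = \<bar>LST F (t * s) - LST G (t * s)\<bar> / t"
      using False t by (simp add: sigma_integrand_def diff_divide_distrib[symmetric] abs_minus_commute)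
    also have "\<dots> \<le> K * (t * s)\<^sup>2 / t" using K[of "t * s"] t s by (intro divide_right_mono) auto
    also have "\<dots> = t * (K * s\<^sup>2)" using False by (simp add: power2_eq_square)
    finally show ?thesis .
  qed
  hence ae: "AE \<omega> in M. \<bar>sigma_integrand F (T \<omega>) s - sigma_integrand G (T \<omega>) s\<bar> \<le> T \<omega> * (K * s\<^sup>2)"
    using T_nonneg by (auto elim!: eventually_mono)
  have "\<bar>sig F s - sig G s\<bar> = \<bar>expectation (\<lambda>\<omega>. sigma_integrand F (T \<omega>) s - sigma_integrand G (T \<omega>) s)\<bar>"
    using i by (simp add: sig_def)
  also have "\<dots> \<le> expectation (\<lambda>\<omega>. \<bar>sigma_integrand F (T \<omega>) s - sigma_integrand G (T \<omega>) s\<bar>)"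
    by (rule integral_abs_bound)
  also have "\<dots> \<le> expectation (\<lambda>\<omega>. T \<omega> * (K * s\<^sup>2))"
    by (rule integral_mono_AE) (use i T_int ae in auto)
  finally have sig_diff: "\<bar>sig F s - sig G s\<bar> \<le> expectation T * K * s\<^sup>2" by simp
  have le: "\<bar>phi (sigB x) - phi (sigB y)\<bar> \<le> y - x" if "0 \<le> x" "x \<le> y" for x y
    using phi_diff[OF AL, of "sigB x" "sigB y"] sigB_diff[OF that] sigB_bounds(1)[OF that(1)] by linarith
  have "\<bar>equation_rhs F s - equation_rhs G s\<bar> \<le> \<bar>sig F s - sig G s\<bar>"
    using le[of "sig F s" "sig G s"] le[of "sig G s" "sig F s"] sig_bounds(1)[OF F s] sig_bounds(1)[OF G s]
    unfolding equation_rhs_def by linarith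
  thus ?thesis using sig_diff by linarith
qed

text \<open>The upper bounds of the three remainders add up to the left side of the hypothesis on \<open>m\<close>, times
  \<open>s\<^sup>2/2\<close>; any \<open>m\<close> satisfying it therefore yields an invariant class.\<close>

lemma equation_rhs_moments_below:
  assumes T_int: "integrable M T" and B_int: "integrable M B"
    and AL: "integrable M (\<lambda>\<omega>. A \<omega> * L \<omega>)" "expectation (\<lambda>\<omega>. A \<omega> * L \<omega>) = 1"
    and D: "integrable M (\<lambda>\<omega>. A \<omega> * (A \<omega> + 1) * (L \<omega>)\<^sup>2)"
    and m: "(expectation (\<lambda>\<omega>. A \<omega> * (A \<omega> + 1) * (L \<omega>)\<^sup>2) + expectation B) * \<mu>\<^sup>2 + expectation T * m \<le> m"
    and F: "moments_below \<mu> m F"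
  obtains G where "moments_below \<mu> m G" "\<And>s. 0 \<le> s \<Longrightarrow> LST G s = equation_rhs F s"
proof -
  have F': "nonneg_distribution F" "has_mean F \<mu>" using F by (auto simp: moments_below_def)
  obtain G where G: "nonneg_distribution G" and LG: "\<And>s. 0 \<le> s \<Longrightarrow> LST G s = equation_rhs F s"
    using is_LST_equation_rhs[OF F'] unfolding is_LST_def by metis
  define d where "d = expectation (\<lambda>\<omega>. A \<omega> * (A \<omega> + 1) * (L \<omega>)\<^sup>2)"
  have d0: "0 \<le> d" unfolding d_def
    by (rule integral_nonneg_AE, use A_nonneg in eventually_elim) auto
  have b0: "0 \<le> expectation B" by (rule integral_nonneg_AE[OF B_nonneg])
  have bounds: "1 - \<mu> * s \<le> equation_rhs F s \<and> equation_rhs F s \<le> 1 - \<mu> * s + m / 2 * s\<^sup>2" if s: "0 \<le> s" for s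
  proof -
    define y where "y = sig F s"
    define u where "u = sigB y"
    have y: "0 \<le> y" "y \<le> \<mu> * s" using sig_bounds[OF F' s] by (auto simp: y_def)
    have u: "0 \<le> u" "u \<le> y" using sigB_bounds[OF y(1)] by (auto simp: u_def)
    note ph = phi_remainder[OF u(1) AL]
    have "phi u - 1 + u \<le> expectation (\<lambda>\<omega>. u\<^sup>2 / 2 * (A \<omega> * (A \<omega> + 1) * (L \<omega>)\<^sup>2))"
      unfolding ph(1)
    proof (rule integral_mono_AE)
      show "AE \<omega> in M. (1 + L \<omega> * u) powr (- A \<omega>) - 1 + A \<omega> * L \<omega> * u \<le> u\<^sup>2 / 2 * (A \<omega> * (A \<omega> + 1) * (L \<omega>)\<^sup>2)"
        using A_nonneg L_nonneg
      proof eventually_elim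
        case (elim \<omega>)
        have "(1 + L \<omega> * u) powr (- A \<omega>) \<le> 1 - A \<omega> * (L \<omega> * u) + A \<omega> * (A \<omega> + 1) / 2 * (L \<omega> * u)\<^sup>2"
          by (rule one_plus_powr_le) (use elim u in auto)
        also have "\<dots> = 1 - A \<omega> * L \<omega> * u + u\<^sup>2 / 2 * (A \<omega> * (A \<omega> + 1) * (L \<omega>)\<^sup>2)"
          by (simp add: power_mult_distrib)
        finally show ?case by simp
      qed
    qed (use phi_integrable[OF u(1)] AL D in auto)
    hence 1: "phi u \<le> 1 - u + d / 2 * u\<^sup>2" using D by (simp add: d_def mult.commute)
    have "y - u = expectation (\<lambda>\<omega>. y - exp_primitive (B \<omega>) y)"
      using sigB_integrable[OF y(1)] by (simp add: u_def sigB_def prob_space)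
    also have "\<dots> \<le> expectation (\<lambda>\<omega>. B \<omega> * (y\<^sup>2 / 2))"
    proof (rule integral_mono_AE)
      show "AE \<omega> in M. y - exp_primitive (B \<omega>) y \<le> B \<omega> * (y\<^sup>2 / 2)"
        using B_nonneg
      proof eventually_elim
        case (elim \<omega>)
        show ?case using exp_primitive_ge[OF elim y(1)] by simp
      qed
    qed (use sigB_integrable[OF y(1)] B_int in auto)
    finally have 2: "y - u \<le> expectation B / 2 * y\<^sup>2" by simp
    have "\<mu> * s - y = expectation (\<lambda>\<omega>. \<mu> * s - sigma_integrand F (T \<omega>) s)"
      using sig_integrable[OF F' s] by (simp add: y_def sig_def prob_space)
    also have "\<dots> \<le> expectation (\<lambda>\<omega>. T \<omega> * (m / 2 * s\<^sup>2))"
    proof (rule integral_mono_AE)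
      show "AE \<omega> in M. \<mu> * s - sigma_integrand F (T \<omega>) s \<le> T \<omega> * (m / 2 * s\<^sup>2)"
        using T_nonneg
      proof eventually_elim
        case (elim \<omega>)
        show ?case using sigma_integrand_lower[OF F elim s] by simp
      qed
    qed (use sig_integrable[OF F' s] T_int in auto)
    finally have 3: "\<mu> * s - y \<le> expectation T * m / 2 * s\<^sup>2" by simp
    have "u\<^sup>2 \<le> (\<mu> * s)\<^sup>2" "y\<^sup>2 \<le> (\<mu> * s)\<^sup>2" using u y by (intro power_mono; linarith)+
    hence "d / 2 * u\<^sup>2 \<le> d / 2 * (\<mu> * s)\<^sup>2" "expectation B / 2 * y\<^sup>2 \<le> expectation B / 2 * (\<mu> * s)\<^sup>2"
      using d0 b0 by (intro mult_left_mono; simp)+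
    with 1 2 3 have "phi u \<le> 1 - \<mu> * s + (expectation T * m / 2 * s\<^sup>2 + expectation B / 2 * (\<mu> * s)\<^sup>2 + d / 2 * (\<mu> * s)\<^sup>2)"
      by linarith
    also have "expectation T * m / 2 * s\<^sup>2 + expectation B / 2 * (\<mu> * s)\<^sup>2 + d / 2 * (\<mu> * s)\<^sup>2
        = ((d + expectation B) * \<mu>\<^sup>2 + expectation T * m) / 2 * s\<^sup>2"
      by (simp add: field_simps power_mult_distrib)
    also have "\<dots> \<le> m / 2 * s\<^sup>2" using m by (intro mult_right_mono) (auto simp: d_def)
    finally have hi: "phi u \<le> 1 - \<mu> * s + m / 2 * s\<^sup>2" by simp
    have "1 - \<mu> * s \<le> phi u" using ph(2) u y by linarith
    thus ?thesis using hi by (simp add: equation_rhs_def u_def y_def)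
  qed
  have "moments_below \<mu> m G"
    by (rule moments_below_of_LST_bounds[OF G]) (use bounds LG in auto)
  thus thesis using LG by (rule that)
qed

lemma fixed_point_unique:
  assumes T_int: "integrable M T" "expectation T < 1"
    and AL: "integrable M (\<lambda>\<omega>. A \<omega> * L \<omega>)" "expectation (\<lambda>\<omega>. A \<omega> * L \<omega>) = 1"
    and F: "moments_below \<mu> m F" "\<And>s. 0 \<le> s \<Longrightarrow> LST F s = equation_rhs F s"
    and G: "moments_below \<mu> m G" "\<And>s. 0 \<le> s \<Longrightarrow> LST G s = equation_rhs G s"
  shows "F = G"
proof -
  have F': "nonneg_distribution F" "has_mean F \<mu>" and G': "nonneg_distribution G" "has_mean G \<mu>"
    using F G by (auto simp: moments_below_def)
  define q where "q = expectation T"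
  have q: "0 \<le> q" "q < 1" using T_int integral_nonneg_AE[OF T_nonneg] by (auto simp: q_def)
  have *: "\<bar>LST F s - LST G s\<bar> \<le> q ^ n * (m / 2) * s\<^sup>2" if "0 \<le> s" for n s
    using that
  proof (induction n arbitrary: s)
    case 0
    thus ?case using LST_diff_quadratic[OF F(1) G(1)] by simp
  next
    case (Suc n)
    from equation_rhs_contracts[OF T_int(1) AL F' G' Suc.IH Suc.prems]
    show ?case using F(2)[OF Suc.prems] G(2)[OF Suc.prems] by (simp add: q_def mult.assoc)
  qed
  show ?thesis
  proof (rule LST_inj[OF F'(1) G'(1)])
    fix s :: real assume s: "0 \<le> s"
    have "(\<lambda>n. q ^ n * (m / 2) * s\<^sup>2) \<longlonglongrightarrow> 0 * (m / 2) * s\<^sup>2"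
      by (intro tendsto_intros LIMSEQ_realpow_zero q)
    hence "\<bar>LST F s - LST G s\<bar> \<le> 0 * (m / 2) * s\<^sup>2"
      by (rule LIMSEQ_le_const) (use *[OF s] in auto)
    thus "LST F s = LST G s" by simp
  qed
qed

text \<open>All iterates lie in one class of finite diameter \<open>m/2\<close>, and \<open>F\<^sub>n\<^sub>+\<^sub>k\<close> and \<open>F\<^sub>n\<close> are the \<open>n\<close>-th images of
  \<open>F\<^sub>k\<close> and \<open>F\<^sub>0\<close>. So their distance is at most \<open>q\<^sup>n m/2\<close> with \<open>q = E[T]\<close>, and no geometric series has
  to be summed.\<close>

lemma fixed_point_exists:
  assumes T_int: "integrable M T" "expectation T < 1" and B_int: "integrable M B"
    and AL: "integrable M (\<lambda>\<omega>. A \<omega> * L \<omega>)" "expectation (\<lambda>\<omega>. A \<omega> * L \<omega>) = 1"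
    and D: "integrable M (\<lambda>\<omega>. A \<omega> * (A \<omega> + 1) * (L \<omega>)\<^sup>2)"
    and m: "(expectation (\<lambda>\<omega>. A \<omega> * (A \<omega> + 1) * (L \<omega>)\<^sup>2) + expectation B) * \<mu>\<^sup>2 + expectation T * m \<le> m"
    and mu: "0 \<le> \<mu>" "\<mu>\<^sup>2 \<le> m"
  obtains F where "moments_below \<mu> m F" "\<And>s. 0 \<le> s \<Longrightarrow> LST F s = equation_rhs F s"
proof -
  define q where "q = expectation T"
  have q: "0 \<le> q" "q < 1" using T_int integral_nonneg_AE[OF T_nonneg] by (auto simp: q_def)
  have start: "\<exists>F. moments_below \<mu> m F"
  proof -
    obtain F where F: "nonneg_distribution F" and LF: "\<And>s. 0 \<le> s \<Longrightarrow> exp (- (\<mu> * s)) = LST F s"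
      using is_LST_exp[OF mu(1)] unfolding is_LST_def by blast
    have "moments_below \<mu> m F"
    proof (rule moments_below_of_LST_bounds[OF F])
      fix s :: real assume s: "0 \<le> s"
      show "1 - \<mu> * s \<le> LST F s" using exp_ge_add_one_self[of "- (\<mu> * s)"] LF[OF s] by simp
      have "LST F s \<le> 1 - \<mu> * s + \<mu>\<^sup>2 / 2 * s\<^sup>2"
        using exp_minus_le_quadratic[OF mult_nonneg_nonneg[OF mu(1) s]] LF[OF s] by (simp add: power_mult_distrib)
      also have "\<mu>\<^sup>2 / 2 * s\<^sup>2 \<le> m / 2 * s\<^sup>2" using mu(2) by (intro mult_right_mono) auto
      finally show "LST F s \<le> 1 - \<mu> * s + m / 2 * s\<^sup>2" by simp
    qed
    thus ?thesis by blast
  qed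
  have "\<exists>F. \<forall>n. moments_below \<mu> m (F n) \<and> (\<forall>s\<ge>0. LST (F (Suc n)) s = equation_rhs (F n) s)"
  proof (rule dependent_nat_choice)
    show "\<exists>F. moments_below \<mu> m F" by (rule start)
    fix F and n :: nat assume "moments_below \<mu> m F"
    then obtain G where "moments_below \<mu> m G" "\<And>s. 0 \<le> s \<Longrightarrow> LST G s = equation_rhs F s"
      using equation_rhs_moments_below[OF T_int(1) B_int AL D m] by blast
    thus "\<exists>G. moments_below \<mu> m G \<and> (\<forall>s\<ge>0. LST G s = equation_rhs F s)" by blast
  qed
  then obtain F where F: "\<And>n. moments_below \<mu> m (F n)"
    and next_LST: "\<And>n s. 0 \<le> s \<Longrightarrow> LST (F (Suc n)) s = equation_rhs (F n) s" by blast
  have F': "nonneg_distribution (F n)" "has_mean (F n) \<mu>" for n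
    using F[of n] by (auto simp: moments_below_def)
  have close: "\<bar>LST (F (n + k)) s - LST (F n) s\<bar> \<le> q ^ n * (m / 2) * s\<^sup>2" if "0 \<le> s" for n k s
    using that
  proof (induction n arbitrary: s)
    case 0
    thus ?case using LST_diff_quadratic[OF F F] by simp
  next
    case (Suc n)
    from equation_rhs_contracts[OF T_int(1) AL F' F' Suc.IH Suc.prems]
    show ?case using next_LST[OF Suc.prems] by (simp add: q_def mult.assoc)
  qed
  have rate: "(\<lambda>n. q ^ n * (m / 2) * s\<^sup>2) \<longlonglongrightarrow> 0" for s :: real
  proof -
    have "(\<lambda>n. q ^ n * (m / 2) * s\<^sup>2) \<longlonglongrightarrow> 0 * (m / 2) * s\<^sup>2"
      by (intro tendsto_intros LIMSEQ_realpow_zero q)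
    thus ?thesis by simp
  qed
  define g where "g s = lim (\<lambda>n. LST (F n) s)" for s
  have lim: "(\<lambda>n. LST (F n) s) \<longlonglongrightarrow> g s" if s: "0 \<le> s" for s
  proof -
    have "Cauchy (\<lambda>n. LST (F n) s)"
    proof (rule CauchyI')
      fix e :: real assume "0 < e"
      then obtain N where N: "\<And>n. N \<le> n \<Longrightarrow> q ^ n * (m / 2) * s\<^sup>2 < e"
        using order_tendstoD(2)[OF rate[of s]] by (auto simp: eventually_sequentially)
      have "dist (LST (F i) s) (LST (F j) s) < e" if "N \<le> i" "i < j" for i j
        using close[OF s, of i "j - i"] N[OF that(1)] that by (simp add: dist_real_def abs_minus_commute)
      thus "\<exists>N. \<forall>i\<ge>N. \<forall>j>i. dist (LST (F i) s) (LST (F j) s) < e" by blast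
    qed
    thus ?thesis unfolding g_def by (simp add: Cauchy_convergent_iff convergent_LIMSEQ_iff)
  qed
  have g_lo: "1 - \<mu> * s \<le> g s" if s: "0 \<le> s" for s
    by (rule LIMSEQ_le_const[OF lim[OF s]]) (use LST_lower[OF F' s] in auto)
  have g_hi: "g s \<le> 1 - \<mu> * s + m / 2 * s\<^sup>2" if s: "0 \<le> s" for s
    by (rule LIMSEQ_le_const2[OF lim[OF s]]) (use LST_upper[OF F s] in auto)
  have "is_LST g"
  proof (rule is_LST_limit)
    show "is_LST (LST (F n))" for n using F' unfolding is_LST_def by blast
    show "(g \<longlongrightarrow> 1) (at_right 0)"
    proof (rule tendsto_sandwich)
      have "((\<lambda>s. 1 - \<mu> * s) \<longlongrightarrow> 1 - \<mu> * 0) (at_right 0)" by (intro tendsto_intros)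
      thus "((\<lambda>s. 1 - \<mu> * s) \<longlongrightarrow> 1) (at_right 0)" by simp
      have "((\<lambda>s. 1 - \<mu> * s + m / 2 * s\<^sup>2) \<longlongrightarrow> 1 - \<mu> * 0 + m / 2 * 0\<^sup>2) (at_right 0)" by (intro tendsto_intros)
      thus "((\<lambda>s. 1 - \<mu> * s + m / 2 * s\<^sup>2) \<longlongrightarrow> 1) (at_right 0)" by simp
    qed (use eventually_at_right_less[of "0::real"] g_lo g_hi in \<open>auto elim!: eventually_mono\<close>)
  qed (rule lim)
  then obtain G where G: "nonneg_distribution G" "\<And>s. 0 \<le> s \<Longrightarrow> g s = LST G s"
    unfolding is_LST_def by blast
  have mG: "moments_below \<mu> m G"
    by (rule moments_below_of_LST_bounds[OF G(1)]) (use g_lo g_hi G(2) in auto)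
  hence G': "nonneg_distribution G" "has_mean G \<mu>" by (auto simp: moments_below_def)
  have closeG: "\<bar>LST G s - LST (F n) s\<bar> \<le> q ^ n * (m / 2) * s\<^sup>2" if s: "0 \<le> s" for n s
  proof (rule LIMSEQ_le_const2)
    have "(\<lambda>k. LST (F (k + n)) s) \<longlonglongrightarrow> g s" by (rule LIMSEQ_ignore_initial_segment[OF lim[OF s]])
    thus "(\<lambda>k. \<bar>LST (F (n + k)) s - LST (F n) s\<bar>) \<longlonglongrightarrow> \<bar>LST G s - LST (F n) s\<bar>"
      using G(2)[OF s] by (intro tendsto_intros) (simp add: add.commute)
  qed (use close[OF s] in auto)
  have "LST G s = equation_rhs G s" if s: "0 \<le> s" for s
  proof -
    have "(\<lambda>n. equation_rhs (F n) s - equation_rhs G s) \<longlonglongrightarrow> 0"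
    proof (rule Lim_null_comparison)
      have "(\<lambda>n. q * (q ^ n * (m / 2) * s\<^sup>2)) \<longlonglongrightarrow> q * 0" by (intro tendsto_intros rate)
      thus "(\<lambda>n. q * (q ^ n * (m / 2) * s\<^sup>2)) \<longlonglongrightarrow> 0" by simp
      show "\<forall>\<^sub>F n in sequentially. norm (equation_rhs (F n) s - equation_rhs G s) \<le> q * (q ^ n * (m / 2) * s\<^sup>2)"
      proof (intro always_eventually allI)
        fix n
        from equation_rhs_contracts[OF T_int(1) AL G' F'[of n] closeG s]
        show "norm (equation_rhs (F n) s - equation_rhs G s) \<le> q * (q ^ n * (m / 2) * s\<^sup>2)"
          by (simp add: q_def mult.assoc abs_minus_commute)
      qed
    qed
    hence "(\<lambda>n. equation_rhs (F n) s) \<longlonglongrightarrow> equation_rhs G s" by (rule LIM_zero_cancel)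
    moreover have "(\<lambda>n. equation_rhs (F n) s) \<longlonglongrightarrow> LST G s"
      using LIMSEQ_Suc[OF lim[OF s]] G(2)[OF s] by (simp add: next_LST[OF s])
    ultimately show ?thesis using LIMSEQ_unique by blast
  qed
  with mG show thesis by (rule that)
qed

section \<open>The characterization of solvability\<close>

lemma mean_product_second_moment:
  assumes AL: "integrable M (\<lambda>\<omega>. A \<omega> * L \<omega>)" "expectation (\<lambda>\<omega>. A \<omega> * L \<omega>) = 1"
    and AL2: "integrable M (\<lambda>\<omega>. (A \<omega> * L \<omega>)\<^sup>2)" 
  shows "variance (\<lambda>\<omega>. A \<omega> * L \<omega>) = expectation (\<lambda>\<omega>. (A \<omega> * L \<omega>)\<^sup>2) - 1"
    "1 \<le> expectation (\<lambda>\<omega>. (A \<omega> * L \<omega>)\<^sup>2)"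
  using variance_eq[OF AL(1) AL2] variance_positive[of "\<lambda>\<omega>. A \<omega> * L \<omega>"] AL(2) by auto

lemma second_moment_split:
  assumes "integrable M (\<lambda>\<omega>. (A \<omega> * L \<omega>)\<^sup>2)" "integrable M (\<lambda>\<omega>. A \<omega> * (L \<omega>)\<^sup>2)"
  shows "integrable M (\<lambda>\<omega>. A \<omega> * (A \<omega> + 1) * (L \<omega>)\<^sup>2)"
    "expectation (\<lambda>\<omega>. A \<omega> * (A \<omega> + 1) * (L \<omega>)\<^sup>2)
      = expectation (\<lambda>\<omega>. (A \<omega> * L \<omega>)\<^sup>2) + expectation (\<lambda>\<omega>. A \<omega> * (L \<omega>)\<^sup>2)"
proof -
  have "A \<omega> * (A \<omega> + 1) * (L \<omega>)\<^sup>2 = (A \<omega> * L \<omega>)\<^sup>2 + A \<omega> * (L \<omega>)\<^sup>2" for \<omega>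
    by (simp add: power2_eq_square algebra_simps)
  thus "integrable M (\<lambda>\<omega>. A \<omega> * (A \<omega> + 1) * (L \<omega>)\<^sup>2)"
    "expectation (\<lambda>\<omega>. A \<omega> * (A \<omega> + 1) * (L \<omega>)\<^sup>2)
      = expectation (\<lambda>\<omega>. (A \<omega> * L \<omega>)\<^sup>2) + expectation (\<lambda>\<omega>. A \<omega> * (L \<omega>)\<^sup>2)"
    using assms by simp_all
qed

lemma second_moment_split_converse:
  assumes "integrable M (\<lambda>\<omega>. A \<omega> * (A \<omega> + 1) * (L \<omega>)\<^sup>2)"
  shows "integrable M (\<lambda>\<omega>. (A \<omega> * L \<omega>)\<^sup>2)" "integrable M (\<lambda>\<omega>. A \<omega> * (L \<omega>)\<^sup>2)"
proof -
  have "AE \<omega> in M. norm ((A \<omega> * L \<omega>)\<^sup>2) \<le> norm (A \<omega> * (A \<omega> + 1) * (L \<omega>)\<^sup>2) \<and>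
      norm (A \<omega> * (L \<omega>)\<^sup>2) \<le> norm (A \<omega> * (A \<omega> + 1) * (L \<omega>)\<^sup>2)"
    using A_nonneg
  proof eventually_elim
    case (elim \<omega>)
    have "A \<omega> * (A \<omega> + 1) * (L \<omega>)\<^sup>2 = (A \<omega> * L \<omega>)\<^sup>2 + A \<omega> * (L \<omega>)\<^sup>2"
      by (simp add: power2_eq_square algebra_simps)
    moreover have "0 \<le> (A \<omega> * L \<omega>)\<^sup>2" "0 \<le> A \<omega> * (L \<omega>)\<^sup>2" using elim by auto
    ultimately show ?case by simp
  qed
  thus "integrable M (\<lambda>\<omega>. (A \<omega> * L \<omega>)\<^sup>2)" "integrable M (\<lambda>\<omega>. A \<omega> * (L \<omega>)\<^sup>2)"
    by (auto intro!: Bochner_Integration.integrable_bound[OF assms])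
qed

end

text \<open>Independence gives \<open>E[X\<^sup>2 Y\<^sup>2] = E[X\<^sup>2] E[Y\<^sup>2]\<close> as an identity in \<open>[0, \<infinity>]\<close>, and neither
  factor can vanish when \<open>E[XY] \<noteq> 0\<close>; so finiteness of the product passes to both factors.\<close>

lemma (in prob_space) indep_var_integrable_squares:
  fixes X Y :: "'a \<Rightarrow> real"
  assumes ind: "indep_var borel X borel Y" and sq: "integrable M (\<lambda>\<omega>. (X \<omega> * Y \<omega>)\<^sup>2)"
    and nz: "expectation (\<lambda>\<omega>. X \<omega> * Y \<omega>) \<noteq> 0"
  shows "integrable M (\<lambda>\<omega>. (X \<omega>)\<^sup>2)" "integrable M (\<lambda>\<omega>. (Y \<omega>)\<^sup>2)"
proof -
  have rv[measurable]: "X \<in> borel_measurable M" "Y \<in> borel_measurable M"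
    using indep_var_rv1[OF ind] indep_var_rv2[OF ind] by auto
  let ?X = "distr M borel X" and ?Y = "distr M borel Y"
  interpret X: prob_space ?X by (rule prob_space_distr) measurable
  interpret Y: prob_space ?Y by (rule prob_space_distr) measurable
  have XY: "?X \<Otimes>\<^sub>M ?Y = distr M (borel \<Otimes>\<^sub>M borel) (\<lambda>\<omega>. (X \<omega>, Y \<omega>))"
    using ind indep_var_distribution_eq by blast
  let ?h = "\<lambda>z. ennreal ((fst z)\<^sup>2) * ennreal ((snd z)\<^sup>2)"
  have h: "?h \<in> borel_measurable (borel \<Otimes>\<^sub>M borel :: (real \<times> real) measure)" by measurable
  have h': "?h \<in> borel_measurable (?X \<Otimes>\<^sub>M ?Y)" by measurable
  have "(\<integral>\<^sup>+\<omega>. ennreal ((X \<omega> * Y \<omega>)\<^sup>2) \<partial>M) = (\<integral>\<^sup>+\<omega>. ?h (X \<omega>, Y \<omega>) \<partial>M)"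
    by (simp add: power_mult_distrib ennreal_mult)
  also have "\<dots> = (\<integral>\<^sup>+z. ?h z \<partial>(?X \<Otimes>\<^sub>M ?Y))"
    unfolding XY using h by (subst nn_integral_distr) auto
  also have "\<dots> = (\<integral>\<^sup>+x. \<integral>\<^sup>+y. ennreal (x\<^sup>2) * ennreal (y\<^sup>2) \<partial>?Y \<partial>?X)"
    using Y.nn_integral_fst[OF h'] by simp
  also have "\<dots> = (\<integral>\<^sup>+x. ennreal (x\<^sup>2) \<partial>?X) * (\<integral>\<^sup>+y. ennreal (y\<^sup>2) \<partial>?Y)"
    by (simp add: nn_integral_cmult nn_integral_multc)
  also have "\<dots> = (\<integral>\<^sup>+\<omega>. ennreal ((X \<omega>)\<^sup>2) \<partial>M) * (\<integral>\<^sup>+\<omega>. ennreal ((Y \<omega>)\<^sup>2) \<partial>M)"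
    by (simp add: nn_integral_distr)
  finally have prod: "(\<integral>\<^sup>+\<omega>. ennreal ((X \<omega>)\<^sup>2) \<partial>M) * (\<integral>\<^sup>+\<omega>. ennreal ((Y \<omega>)\<^sup>2) \<partial>M) < top"
    using sq by (simp add: integrable_iff_bounded)
  have AE0: "expectation (\<lambda>\<omega>. X \<omega> * Y \<omega>) = 0" if "AE \<omega> in M. X \<omega> = 0 \<or> Y \<omega> = 0"
    by (rule integral_eq_zero_AE, use that in eventually_elim) auto
  have X0: "(\<integral>\<^sup>+\<omega>. ennreal ((X \<omega>)\<^sup>2) \<partial>M) \<noteq> 0"
  proof
    assume "(\<integral>\<^sup>+\<omega>. ennreal ((X \<omega>)\<^sup>2) \<partial>M) = 0"
    hence "AE \<omega> in M. X \<omega> = 0" by (subst (asm) nn_integral_0_iff_AE) (auto simp: ennreal_eq_0_iff)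
    hence "AE \<omega> in M. X \<omega> = 0 \<or> Y \<omega> = 0" by eventually_elim simp
    thus False using AE0 nz by simp
  qed
  have Y0: "(\<integral>\<^sup>+\<omega>. ennreal ((Y \<omega>)\<^sup>2) \<partial>M) \<noteq> 0"
  proof
    assume "(\<integral>\<^sup>+\<omega>. ennreal ((Y \<omega>)\<^sup>2) \<partial>M) = 0"
    hence "AE \<omega> in M. Y \<omega> = 0" by (subst (asm) nn_integral_0_iff_AE) (auto simp: ennreal_eq_0_iff)
    hence "AE \<omega> in M. X \<omega> = 0 \<or> Y \<omega> = 0" by eventually_elim simp
    thus False using AE0 nz by simp
  qed
  have "(\<integral>\<^sup>+\<omega>. ennreal ((X \<omega>)\<^sup>2) \<partial>M) < top \<and> (\<integral>\<^sup>+\<omega>. ennreal ((Y \<omega>)\<^sup>2) \<partial>M) < top"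
    using prod X0 Y0 by (simp add: ennreal_mult_less_top)
  thus "integrable M (\<lambda>\<omega>. (X \<omega>)\<^sup>2)" "integrable M (\<lambda>\<omega>. (Y \<omega>)\<^sup>2)"
    by (simp_all add: integrable_iff_bounded)
qed

theorem theorem4:
  fixes \<mu> :: real
    and M :: "'w measure"
    and T A L B :: "'w \<Rightarrow> real"
  assumes mu: "0 < \<mu>"
    and M: "prob_space M"
    and rv: "T \<in> borel_measurable M" "A \<in> borel_measurable M"
            "L \<in> borel_measurable M" "B \<in> borel_measurable M"
    and nonneg: "AE \<omega> in M. 0 \<le> T \<omega>" "AE \<omega> in M. 0 \<le> A \<omega>"
                "AE \<omega> in M. 0 \<le> L \<omega>" "AE \<omega> in M. 0 \<le> B \<omega>"
    and indep: "prob_space.indep_var M borel A borel L"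
  defines "moment_conditions \<equiv>
      (integrable M T \<and> 0 \<le> prob_space.expectation M T \<and> prob_space.expectation M T < 1) \<and>
      (integrable M (\<lambda>\<omega>. A \<omega> * L \<omega>) \<and> prob_space.expectation M (\<lambda>\<omega>. A \<omega> * L \<omega>) = 1) \<and>
      integrable M (\<lambda>\<omega>. (A \<omega>)\<^sup>2) \<and>
      integrable M (\<lambda>\<omega>. (L \<omega>)\<^sup>2) \<and>
      (integrable M B \<and> 0 \<le> prob_space.expectation M B)"
    and "solution \<equiv>
      is_solution \<mu> (distr M borel T) (distr M borel A) (distr M borel L) (distr M borel B)"
  shows "(moment_conditions \<longleftrightarrow> (\<exists>!F. solution F)) \<and>
    (moment_conditions \<longrightarrow>
      (\<forall>F. solution F \<longrightarrow>
        prob_space.variance F (\<lambda>x. x) =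
          (prob_space.variance M (\<lambda>\<omega>. A \<omega> * L \<omega>)
            + prob_space.expectation M (\<lambda>\<omega>. A \<omega> * (L \<omega>)\<^sup>2)
            + prob_space.expectation M B + prob_space.expectation M T)
          / (1 - prob_space.expectation M T) * \<mu>\<^sup>2))"
proof -
  interpret equation_data M T A L B
    using M rv nonneg indep by (simp add: equation_data_def equation_data_axioms_def)
  have solution_iff: "solution F \<longleftrightarrow> nonneg_distribution F \<and> has_mean F \<mu> \<and> integrable F (\<lambda>x. x\<^sup>2) \<and>
      (\<forall>s\<ge>0. LST F s = equation_rhs F s)" for F
    unfolding solution_def is_solution_def using finite_variance_iff satisfies_equation_iff by blast
  have B_mean: "0 \<le> expectation B" by (rule integral_nonneg_AE[OF B_nonneg])
  have T_mean: "0 \<le> expectation T" by (rule integral_nonneg_AE[OF T_nonneg])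

  have necessary: "moment_conditions \<and> prob_space.variance F (\<lambda>x. x) =
      (variance (\<lambda>\<omega>. A \<omega> * L \<omega>) + expectation (\<lambda>\<omega>. A \<omega> * (L \<omega>)\<^sup>2) + expectation B + expectation T)
        / (1 - expectation T) * \<mu>\<^sup>2" if "solution F" for F
  proof -
    have F: "nonneg_distribution F" "has_mean F \<mu>" "integrable F (\<lambda>x. x\<^sup>2)"
      and eq: "\<And>s. 0 \<le> s \<Longrightarrow> LST F s = equation_rhs F s"
      using that solution_iff by auto
    interpret F: prob_space F by (rule nonneg_distributionD[OF F(1)])
    define m where "m = (LINT x|F. x\<^sup>2)"
    define d where "d = expectation (\<lambda>\<omega>. (A \<omega> * L \<omega>)\<^sup>2) + expectation (\<lambda>\<omega>. A \<omega> * (L \<omega>)\<^sup>2) + expectation B"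
    have AL: "integrable M (\<lambda>\<omega>. A \<omega> * L \<omega>)" "expectation (\<lambda>\<omega>. A \<omega> * L \<omega>) = 1"
      and D: "integrable M (\<lambda>\<omega>. A \<omega> * (A \<omega> + 1) * (L \<omega>)\<^sup>2)" and BT: "integrable M B" "integrable M T"
      and m_eq: "m = (expectation (\<lambda>\<omega>. A \<omega> * (A \<omega> + 1) * (L \<omega>)\<^sup>2) + expectation B) * \<mu>\<^sup>2 + expectation T * m"
      using expansion_at_solution[OF mu F eq] by (auto simp: m_def)
    note AL2 = second_moment_split_converse[OF D]
    note one = mean_product_second_moment[OF AL AL2(1)]
    have "0 \<le> expectation (\<lambda>\<omega>. A \<omega> * (L \<omega>)\<^sup>2)"
      by (rule integral_nonneg_AE, use A_nonneg in eventually_elim) auto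
    hence d: "1 \<le> d" using one(2) B_mean by (simp add: d_def)
    have m_eq': "m * (1 - expectation T) = d * \<mu>\<^sup>2"
      using m_eq second_moment_split(2)[OF AL2] by (simp add: d_def algebra_simps)
    have "0 < m * (1 - expectation T)" unfolding m_eq' using d mu by simp
    moreover have "0 \<le> m" unfolding m_def by simp
    ultimately have ET: "expectation T < 1" by (simp add: zero_less_mult_iff)
    have sq: "integrable M (\<lambda>\<omega>. (A \<omega>)\<^sup>2)" "integrable M (\<lambda>\<omega>. (L \<omega>)\<^sup>2)"
      using indep_var_integrable_squares[OF indep AL2(1)] AL(2) by simp_all
    have "moment_conditions"
      unfolding moment_conditions_def using sq AL BT ET B_mean T_mean by blast
    moreover have "F.variance (\<lambda>x. x) = m - \<mu>\<^sup>2"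
      using F.variance_eq[of "\<lambda>x. x"] F(2,3) by (simp add: has_mean_def mean_def m_def)
    moreover have "m = d * \<mu>\<^sup>2 / (1 - expectation T)" using m_eq' ET by (simp add: field_simps)
    moreover have "variance (\<lambda>\<omega>. A \<omega> * L \<omega>) + expectation (\<lambda>\<omega>. A \<omega> * (L \<omega>)\<^sup>2) + expectation B + expectation T
        = d - (1 - expectation T)"
      unfolding one(1) d_def by simp
    moreover have "d * \<mu>\<^sup>2 / (1 - expectation T) - \<mu>\<^sup>2 = (d - (1 - expectation T)) / (1 - expectation T) * \<mu>\<^sup>2"
      using ET by (simp add: field_simps)
    ultimately show ?thesis by (simp only: simp_thms)
  qed

  have sufficient: "\<exists>!F. solution F" if "moment_conditions"
  proof -
    have T_int: "integrable M T" "expectation T < 1" and B_int: "integrable M B"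
      and AL: "integrable M (\<lambda>\<omega>. A \<omega> * L \<omega>)" "expectation (\<lambda>\<omega>. A \<omega> * L \<omega>) = 1"
      and sq: "integrable M (\<lambda>\<omega>. (A \<omega>)\<^sup>2)" "integrable M (\<lambda>\<omega>. (L \<omega>)\<^sup>2)"
      using that unfolding moment_conditions_def by auto
    have ind: "indep_var borel (\<lambda>\<omega>. (A \<omega>)\<^sup>2) borel (\<lambda>\<omega>. (L \<omega>)\<^sup>2)" "indep_var borel A borel (\<lambda>\<omega>. (L \<omega>)\<^sup>2)"
      using indep_var_compose[OF indep, of "\<lambda>x. x\<^sup>2" borel "\<lambda>x. x\<^sup>2" borel]
        indep_var_compose[OF indep, of "\<lambda>x. x" borel "\<lambda>x. x\<^sup>2" borel] by (auto simp: comp_def)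
    have A_int: "integrable M A" by (rule square_integrable_imp_integrable[OF A sq(1)])
    have AL2: "integrable M (\<lambda>\<omega>. (A \<omega> * L \<omega>)\<^sup>2)"
      using indep_var_integrable[OF ind(1) sq] by (simp add: power_mult_distrib)
    have AL2': "integrable M (\<lambda>\<omega>. A \<omega> * (L \<omega>)\<^sup>2)" by (rule indep_var_integrable[OF ind(2) A_int sq(2)])
    note D = second_moment_split[OF AL2 AL2']
    define d where "d = expectation (\<lambda>\<omega>. A \<omega> * (A \<omega> + 1) * (L \<omega>)\<^sup>2) + expectation B"
    have "0 \<le> expectation (\<lambda>\<omega>. A \<omega> * (L \<omega>)\<^sup>2)"
      by (rule integral_nonneg_AE, use A_nonneg in eventually_elim) auto
    hence d: "1 \<le> d" using mean_product_second_moment(2)[OF AL AL2] B_mean D(2) by (simp add: d_def)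
    \<comment> \<open>the second moment that a solution must have by the expansion at \<open>0\<close>\<close>
    define m where "m = d * \<mu>\<^sup>2 / (1 - expectation T)"
    have m: "d * \<mu>\<^sup>2 + expectation T * m = m" using T_int(2) by (simp add: m_def field_simps)
    have m_ge: "\<mu>\<^sup>2 \<le> m"
    proof -
      have "\<mu>\<^sup>2 * (1 - expectation T) \<le> \<mu>\<^sup>2 * d" using d T_mean by (intro mult_left_mono) auto
      thus ?thesis using T_int(2) by (simp add: m_def le_divide_eq mult.commute)
    qed
    obtain F where F: "moments_below \<mu> m F" "\<And>s. 0 \<le> s \<Longrightarrow> LST F s = equation_rhs F s"
      using fixed_point_exists[OF T_int B_int AL D(1), of \<mu> m] m m_ge mu unfolding d_def by auto
    have "solution F" using F by (simp add: solution_iff moments_below_def)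
    moreover have "G = H" if "solution G" "solution H" for G H
    proof -
      define k where "k = max (LINT x|G. x\<^sup>2) (LINT x|H. x\<^sup>2)"
      have "moments_below \<mu> k G" "moments_below \<mu> k H"
        using that by (auto simp: solution_iff moments_below_def k_def)
      thus ?thesis using fixed_point_unique[OF T_int AL] that by (simp add: solution_iff)
    qed
    ultimately show ?thesis by blast
  qed
  show ?thesis using necessary sufficient by blast
qed

end
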